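(* Let $V,W\subset\mathbb{C}^n$ be germs at $0$ of complex analytic varieties with $0\in V\cap W$, let $A\subset\mathbb{C}^n$ be a set-germ at $0$ with $0\in\overline{A}$, and suppose there is a bi-Lipschitz homeomorphism germ $h:(\mathbb{C}^n,0)\to(\mathbb{C}^n,0)$ with $h(V)=W$. Then $LD^*(A)\cap LD^*(V)=\{0\}$ if and only if $LD^*(h(A))\cap LD^*(W)=\{0\}$.
   Context: A bi-Lipschitz homeomorphism germ $h:(\mathbb{C}^n,0)\to(\mathbb{C}^n,0)$ is a homeomorphism germ with $h(0)=0$ and constants $0<K_1\le K_2$ with $K_1\|x-y\|\le\|h(x)-h(y)\|\le K_2\|x-y\|$ near $0$. For a set-germ $A\subset\mathbb{C}^n$ at $0$ with $0\in\overline{A}$, the complex tangent cone is $LD^*(A)=\{v\in\mathbb{C}^n:\ \exists\, c_i\in\mathbb{C},\ \exists\, v_i\in A\setminus\{0\},\ v_i\to0,\ c_iv_i\to v\}$. *)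

theory Defs
  imports "HOL-Analysis.Analysis"
begin

definition holomorphic_n :: "(complex^'n \<Rightarrow> complex) \<Rightarrow> (complex^'n) set \<Rightarrow> bool" where
  "holomorphic_n f U \<longleftrightarrow>
     (\<forall>x\<in>U. \<exists>f'. (f has_derivative f') (at x) \<and> (\<forall>c v. f' (c *s v) = c * f' v))"

definition analytic_variety_germ :: "(complex^'n) set \<Rightarrow> bool" where
  "analytic_variety_germ V \<longleftrightarrow>
     (\<exists>U F. open U \<and> 0 \<in> U \<and> finite F \<and> (\<forall>f\<in>F. holomorphic_n f U) \<and>
            V \<inter> U = {x\<in>U. \<forall>f\<in>F. f x = 0})"

text \<open>Bi-Lipschitz homeomorphism germ h : (C^n,0) -> (C^n,0), represented on an open
  neighbourhood U of 0 (bi-Lipschitz on U implies h is a homeomorphism onto its image).\<close>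
definition bilipschitz_germ_on :: "(complex^'n \<Rightarrow> complex^'n) \<Rightarrow> (complex^'n) set \<Rightarrow> bool" where
  "bilipschitz_germ_on h U \<longleftrightarrow>
     open U \<and> 0 \<in> U \<and> h 0 = 0 \<and> homeomorphism U (h ` U) h (inv_into U h) \<and>
     (\<exists>K1 K2. 0 < K1 \<and> K1 \<le> K2 \<and>
        (\<forall>x\<in>U. \<forall>y\<in>U. K1 * dist x y \<le> dist (h x) (h y) \<and> dist (h x) (h y) \<le> K2 * dist x y))"

definition LDstar :: "(complex^'n) set \<Rightarrow> (complex^'n) set" where
  "LDstar A = {v. \<exists>(c::nat \<Rightarrow> complex) u. (\<forall>i. u i \<in> A - {0}) \<and> u \<longlonglongrightarrow> 0 \<and>
                     (\<lambda>i. c i *s u i) \<longlonglongrightarrow> v}"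

end

theory Submission
  imports Defs "HOL-Complex_Analysis.Complex_Analysis"
begin

text \<open>A nonzero common direction of the cones of A and V is equivalent to the existence of points
  a in A and v in V, arbitrarily close to 0, with |a - v| = o(|a|), and the latter condition is
  visibly invariant under bi-Lipschitz maps. That such points produce a common direction is compactness
  of the unit sphere. The converse uses that V is analytic: if v is in LD*(V), then for every small
  complex t there is a point of V at distance o(|t|) from tv. To see this, consider
  X = {(y,t) : t(v+y) in V}. This analytic set accumulates at the origin off the hyperplane t = 0,
  and the claim is that then it meets all fibres t = const near the origin. Eliminate
  the coordinates of y one after the other: some equation of X, after division by a power of t,
  defines a finite branched cover over a space of one dimension less, and the image of X there is again
  cut out by holomorphic functions, namely by norms of functions along this cover.\<close>

section \<open>Functions holomorphic along curves\<close>

text \<open>The obstacle is one of scale. Two arbitrary sets may approach a common direction at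
  widely separated distances from 0, and then no point of one need be relatively close to a point of
  the other, while bi-Lipschitz maps control relative distances and not directions. Analyticity of V
  fills in the missing scales; as the multipliers in the cones are complex, it must do so for all
  small complex t, arguments included. The whole hyperplane t = 0 belongs to X because 0 lies in V.
  The equations of X vanish identically there, so they define no finite cover until a power of t has
  been removed from one of them. The norm of a single function h detects only common zeros of h and
  the divided equation, whereas the image of X asks for one fibre point at which all equations
  vanish. As fibres are finite, a suitable linear combination of the equations tells the two apart,
  so the norms of all linear combinations together cut out the image.\<close>

text \<open>Several-variable holomorphy is encoded as continuity together with holomorphy along a prescribed
  family L of curves, below always the affine complex lines. This notion is stable under
  the substitutions needed to project along a direction.\<close>

definition hol_along :: "(complex \<Rightarrow> 'w::topological_space) set \<Rightarrow> 'w set \<Rightarrow> ('w \<Rightarrow> complex) \<Rightarrow> bool" where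
  "hol_along L D f \<longleftrightarrow> continuous_on D f \<and> (\<forall>l\<in>L. (\<lambda>x. f (l x)) holomorphic_on l -` D)"

text \<open>The sets \<open>D\<close> used later lie over a subspace and need not be open in the
  ambient space. Openness is asked only of the parameter sets cut out by the curves, where
  one-variable holomorphy is tested.\<close>

definition open_along :: "(complex \<Rightarrow> 'w::topological_space) set \<Rightarrow> 'w set \<Rightarrow> bool" where
  "open_along L D \<longleftrightarrow> (\<forall>l\<in>L. continuous_on UNIV l \<and> open (l -` D))"

lemma hol_along_const [simp]: "hol_along L D (\<lambda>w. c)"
  by (simp add: hol_along_def)

lemma hol_along_add: "hol_along L D f \<Longrightarrow> hol_along L D g \<Longrightarrow> hol_along L D (\<lambda>w. f w + g w)"
  and hol_along_mult: "hol_along L D f \<Longrightarrow> hol_along L D g \<Longrightarrow> hol_along L D (\<lambda>w. f w * g w)"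
  by (auto simp: hol_along_def intro!: continuous_intros holomorphic_intros)

lemma hol_along_divide:
  "hol_along L D f \<Longrightarrow> hol_along L D g \<Longrightarrow> (\<And>w. w \<in> D \<Longrightarrow> g w \<noteq> 0) \<Longrightarrow> hol_along L D (\<lambda>w. f w / g w)"
  by (auto simp: hol_along_def intro!: continuous_intros holomorphic_intros)

lemma hol_along_power: "hol_along L D f \<Longrightarrow> hol_along L D (\<lambda>w. f w ^ n)"
  by (auto simp: hol_along_def intro!: continuous_intros holomorphic_intros)

lemma hol_along_sum: "(\<And>i. i \<in> I \<Longrightarrow> hol_along L D (f i)) \<Longrightarrow> hol_along L D (\<lambda>w. \<Sum>i\<in>I. f i w)"
  by (auto simp: hol_along_def intro!: continuous_intros holomorphic_intros)

section \<open>Contour integrals depending on a parameter\<close>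

lemma continuous_on_contour_integral_param:
  fixes \<Phi> :: "'w::topological_space \<Rightarrow> complex \<Rightarrow> complex"
  assumes "continuous_on (D \<times> sphere 0 r) (\<lambda>(w,s). \<Phi> w s)" "r > 0"
  shows "continuous_on D (\<lambda>w. contour_integral (circlepath 0 r) (\<Phi> w))"
proof -
  let ?d = "\<lambda>x. 2 * pi * \<i> * r * exp (2 * of_real pi * \<i> * of_real x)"
  have eq: "contour_integral (circlepath 0 r) (\<Phi> w)
      = integral (cbox 0 1) (\<lambda>x. \<Phi> w (circlepath 0 r x) * ?d x)" for w
    unfolding contour_integral_integral cbox_interval
    by (intro integral_cong) (simp add: vector_derivative_circlepath)
  have "continuous_on (D \<times> cbox 0 1) (\<lambda>p. (\<lambda>(w,s). \<Phi> w s) (fst p, circlepath 0 r (snd p)))"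
  proof (rule continuous_on_compose2[OF assms(1)])
    show "continuous_on (D \<times> cbox 0 1) (\<lambda>p. (fst p, circlepath 0 r (snd p)))"
      unfolding circlepath by (intro continuous_intros)
    show "(\<lambda>p. (fst p, circlepath 0 r (snd p))) ` (D \<times> cbox 0 1) \<subseteq> D \<times> sphere 0 r"
      using path_image_circlepath_nonneg[of r 0] assms(2) by (force simp: path_image_def)
  qed
  then have "continuous_on (D \<times> cbox 0 1) (\<lambda>(w, x). \<Phi> w (circlepath 0 r x) * ?d x)"
    unfolding case_prod_unfold by (intro continuous_intros) (auto simp: case_prod_unfold)
  then show ?thesis
    unfolding eq by (rule integral_continuous_on_param)
qed

text \<open>Morera's theorem on each curve: Fubini exchanges the circle with the sides of a
  triangle, and for fixed \<open>s\<close> the integral around the triangle vanishes by Cauchy. This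
  avoids differentiating under the integral sign.\<close>

lemma hol_along_contour_integral:
  fixes \<Phi> :: "'w::topological_space \<Rightarrow> complex \<Rightarrow> complex"
  assumes L: "open_along L D"
    and cont: "continuous_on (D \<times> sphere 0 r) (\<lambda>(w,s). \<Phi> w s)" and r: "r > 0"
    and hol: "\<And>s. norm s = r \<Longrightarrow> hol_along L D (\<lambda>w. \<Phi> w s)"
  shows "hol_along L D (\<lambda>w. contour_integral (circlepath 0 r) (\<Phi> w))"
  unfolding hol_along_def
proof (intro conjI ballI)
  show c: "continuous_on D (\<lambda>w. contour_integral (circlepath 0 r) (\<Phi> w))"
    by (rule continuous_on_contour_integral_param[OF cont r])
  fix l assume l: "l \<in> L"
  let ?S = "l -` D" and ?F = "\<lambda>x. contour_integral (circlepath 0 r) (\<Phi> (l x))"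
  have S: "open ?S" and lc: "continuous_on UNIV l" using L l by (auto simp: open_along_def)
  have pim: "path_image (circlepath 0 r) = sphere (0::complex) r"
    using r by simp
  have cj: "continuous_on (?S \<times> sphere 0 r) (\<lambda>(x,s). \<Phi> (l x) s)"
  proof -
    have "continuous_on (?S \<times> sphere 0 r) (\<lambda>p. (\<lambda>(w,s). \<Phi> w s) (l (fst p), snd p))"
      by (rule continuous_on_compose2[OF cont])
        (auto intro!: continuous_intros continuous_on_compose2[OF lc])
    then show ?thesis by (simp add: case_prod_unfold)
  qed
  have "?F analytic_on ?S"
  proof (rule Morera_triangle[OF _ S], safe)
    show "continuous_on ?S ?F"
      by (rule continuous_on_compose2[OF c continuous_on_subset[OF lc]]) auto
    fix a b c assume abc: "convex hull {a,b,c} \<subseteq> ?S"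
    have seg: "closed_segment u v \<subseteq> ?S" if "{u,v} \<subseteq> {a,b,c}" for u v
    proof -
      have "closed_segment u v \<subseteq> convex hull {a,b,c}"
        unfolding segment_convex_hull by (rule hull_mono[OF that])
      then show ?thesis using abc by blast
    qed
    have sw: "contour_integral (linepath u v) ?F
        = contour_integral (circlepath 0 r) (\<lambda>s. contour_integral (linepath u v) (\<lambda>x. \<Phi> (l x) s))"
      if "{u,v} \<subseteq> {a,b,c}" for u v
    proof (rule contour_integral_swap)
      show "continuous_on (path_image (linepath u v) \<times> path_image (circlepath 0 r)) (\<lambda>(y1, y2). \<Phi> (l y1) y2)"
        using seg[OF that] r by (intro continuous_on_subset[OF cj]) auto
      show "continuous_on {0..1} (\<lambda>t. vector_derivative (circlepath 0 r) (at t))"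
        by (simp add: vector_derivative_circlepath) (intro continuous_intros)
    qed auto
    have int: "(\<lambda>s. contour_integral (linepath u v) (\<lambda>x. \<Phi> (l x) s)) contour_integrable_on circlepath 0 r"
      if "{u,v} \<subseteq> {a,b,c}" for u v
    proof (rule contour_integrable_continuous_circlepath)
      have "continuous_on (sphere 0 r \<times> cbox 0 1)
         (\<lambda>p. (\<lambda>(x,s). \<Phi> (l x) s) (linepath u v (snd p), fst p))"
      proof (rule continuous_on_compose2[OF cj])
        show "continuous_on (sphere 0 r \<times> cbox 0 1) (\<lambda>p. (linepath u v (snd p), fst p))"
          unfolding linepath_def by (intro continuous_intros)
        show "(\<lambda>p. (linepath u v (snd p), fst p)) ` (sphere 0 r \<times> cbox 0 1) \<subseteq> l -` D \<times> sphere 0 r"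
          using seg[OF that] linepath_in_path[of _ u v] by auto
      qed
      then have "continuous_on (sphere 0 r \<times> cbox 0 1) (\<lambda>(s,x). \<Phi> (l (linepath u v x)) s * (v - u))"
        unfolding case_prod_unfold by (intro continuous_intros) auto
      then have "continuous_on (sphere 0 r) (\<lambda>s. integral (cbox 0 1) (\<lambda>x. \<Phi> (l (linepath u v x)) s * (v - u)))"
        by (rule integral_continuous_on_param)
      then show "continuous_on (path_image (circlepath 0 r)) (\<lambda>s. contour_integral (linepath u v) (\<lambda>x. \<Phi> (l x) s))"
        unfolding pim contour_integral_integral
        by (simp add: vector_derivative_linepath_within)
    qed
    have z: "contour_integral (linepath a b) (\<lambda>x. \<Phi> (l x) s) + contour_integral (linepath b c) (\<lambda>x. \<Phi> (l x) s)
       + contour_integral (linepath c a) (\<lambda>x. \<Phi> (l x) s) = 0" if "norm s = r" for s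
    proof -
      have h: "(\<lambda>x. \<Phi> (l x) s) holomorphic_on ?S" using hol[OF that] l by (auto simp: hol_along_def)
      then have hh: "(\<lambda>x. \<Phi> (l x) s) holomorphic_on convex hull {a,b,c}"
        using abc by (rule holomorphic_on_subset)
      have ci: "(\<lambda>x. \<Phi> (l x) s) contour_integrable_on (linepath u v)" if "{u,v} \<subseteq> {a,b,c}" for u v
        by (rule contour_integrable_continuous_linepath)
          (rule continuous_on_subset[OF holomorphic_on_imp_continuous_on[OF h] seg[OF that]])
      have "((\<lambda>x. \<Phi> (l x) s) has_contour_integral 0) (linepath a b +++ linepath b c +++ linepath c a)"
        by (rule Cauchy_theorem_triangle[OF hh])
      then have "contour_integral (linepath a b +++ linepath b c +++ linepath c a) (\<lambda>x. \<Phi> (l x) s) = 0"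
        by (rule contour_integral_unique)
      then show ?thesis using ci by (simp add: contour_integrable_joinI algebra_simps)
    qed
    have "contour_integral (linepath a b) ?F + contour_integral (linepath b c) ?F + contour_integral (linepath c a) ?F
      = contour_integral (circlepath 0 r) (\<lambda>s. contour_integral (linepath a b) (\<lambda>x. \<Phi> (l x) s) 
          + contour_integral (linepath b c) (\<lambda>x. \<Phi> (l x) s) + contour_integral (linepath c a) (\<lambda>x. \<Phi> (l x) s))"
      by (simp add: sw int contour_integral_add contour_integrable_add)
    also have "\<dots> = contour_integral (circlepath 0 r) (\<lambda>s. 0)"
      by (rule contour_integral_cong) (use z r in auto)
    finally show "contour_integral (linepath a b) ?F + contour_integral (linepath b c) ?F + contour_integral (linepath c a) ?F = 0"
      by simp
  qed
  then show "?F holomorphic_on ?S"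
    by (rule analytic_imp_holomorphic)
qed

section \<open>Eliminating one variable\<close>

text \<open>Newton's identities: newton p n is the n-th elementary symmetric function in terms of
  the power sums p 1, p 2, ...\<close>

fun newton :: "(nat \<Rightarrow> complex) \<Rightarrow> nat \<Rightarrow> complex" where
  "newton p 0 = 1"
| "newton p (Suc n) = (\<Sum>i\<le>n. newton p (n - i) * ((-1)^i * p (Suc i))) / of_nat (Suc n)"

text \<open>\<open>E\<close> is the generating polynomial of the elementary symmetric functions and
  \<open>Q\<close> its logarithmic derivative, a series of signed power sums. Comparing coefficients
  in E' = E Q yields the recursion of \<open>newton\<close>.\<close>

lemma newton_power_sums:
  fixes xs :: "complex list"
  shows "newton (\<lambda>k. \<Sum>x\<leftarrow>xs. x ^ k) (length xs) = prod_list xs"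
proof -
  define E :: "complex list \<Rightarrow> complex fps" where
    "E xs = prod_list (map (\<lambda>x. 1 + fps_const x * fps_X) xs)" for xs
  define Q :: "complex list \<Rightarrow> complex fps" where
    "Q xs = Abs_fps (\<lambda>k. (-1)^k * (\<Sum>x\<leftarrow>xs. x ^ Suc k))" for xs
  have E_simps: "E [] = 1" "E (x # xs) = E xs + fps_X * (fps_const x * E xs)" for x xs
    by (simp_all add: E_def algebra_simps)
  have geo: "(1 + fps_const x * fps_X) * Abs_fps (\<lambda>k. (-1)^k * x ^ Suc k) = fps_const x" for x :: complex
  proof (rule fps_ext)
    fix n
    have "(1 + fps_const x * fps_X) * Abs_fps (\<lambda>k. (-1)^k * x ^ Suc k)
       = Abs_fps (\<lambda>k. (-1)^k * x ^ Suc k) + fps_X * (fps_const x * Abs_fps (\<lambda>k. (-1)^k * x ^ Suc k))"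
      by (simp add: algebra_simps)
    then show "((1 + fps_const x * fps_X) * Abs_fps (\<lambda>k. (-1)^k * x ^ Suc k)) $ n = fps_const x $ n"
      by (cases n) (simp_all add: algebra_simps)
  qed
  have dE: "fps_deriv (E xs) = E xs * Q xs" for xs
  proof (induction xs)
    case Nil
    then show ?case by (simp add: E_simps Q_def fps_eq_iff)
  next
    case (Cons x xs)
    let ?l = "1 + fps_const x * fps_X"
    have Q: "Q (x # xs) = Abs_fps (\<lambda>k. (-1)^k * x ^ Suc k) + Q xs"
      by (simp add: Q_def fps_eq_iff algebra_simps)
    have E: "E (x # xs) = ?l * E xs" by (simp add: E_def)
    have "E (x # xs) * Q (x # xs) = (?l * Abs_fps (\<lambda>k. (-1)^k * x ^ Suc k)) * E xs + ?l * (E xs * Q xs)"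
      by (simp add: E Q algebra_simps)
    also have "\<dots> = fps_const x * E xs + ?l * fps_deriv (E xs)"
      by (simp only: geo Cons.IH)
    also have "\<dots> = fps_deriv (E (x # xs))" by (simp add: E algebra_simps)
    finally show ?case ..
  qed
  have EN: "E xs $ n = newton (\<lambda>k. \<Sum>x\<leftarrow>xs. x ^ k) n" for n
  proof (induction n rule: less_induct)
    case (less n)
    show ?case
    proof (cases n)
      case 0
      have "E xs $ 0 = 1" by (induction xs) (simp_all add: E_simps)
      then show ?thesis using 0 by simp
    next
      case (Suc m)
      have "of_nat (Suc m) * E xs $ Suc m = fps_deriv (E xs) $ m" by simp
      also have "\<dots> = (Q xs * E xs) $ m" by (simp only: dE mult.commute)
      also have "\<dots> = (\<Sum>i\<le>m. newton (\<lambda>k. \<Sum>x\<leftarrow>xs. x ^ k) (m - i) * ((-1)^i * (\<Sum>x\<leftarrow>xs. x ^ Suc i)))"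
        unfolding fps_mult_nth atLeast0AtMost
        by (intro sum.cong) (use less Suc in \<open>auto simp: Q_def\<close>)
      finally show ?thesis unfolding Suc newton.simps
        by (metis nonzero_mult_div_cancel_left of_nat_neq_0)
    qed
  qed
  \<comment> \<open>The vanishing of higher coefficients is carried along because the coefficient of
    \<open>E (x # xs)\<close> at its length contains, besides x times the top coefficient of
    \<open>E xs\<close>, a coefficient of \<open>E xs\<close> beyond its length.\<close>
  have "(\<forall>n > length xs. E xs $ n = 0) \<and> E xs $ length xs = prod_list xs"
  proof (induction xs)
    case (Cons x xs)
    then show ?case by (auto simp: E_simps Suc_less_eq2 gr0_conv_Suc)
  qed (auto simp: E_simps)
  then show ?thesis using EN by simp
qed

text \<open>Turns zeros with multiplicities into a list with repetitions, the form in which Newton's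
  identities are stated.\<close>

lemma weighted_sum_as_list:
  fixes m :: "complex \<Rightarrow> nat"
  assumes "finite Z"
  shows "\<exists>xs. set xs = {z\<in>Z. m z > 0} \<and> (\<forall>f::complex \<Rightarrow> complex. (\<Sum>z\<in>Z. of_nat (m z) * f z) = (\<Sum>x\<leftarrow>xs. f x))"
  using assms
proof (induction Z)
  case (insert z Z)
  then obtain xs where "set xs = {z\<in>Z. m z > 0}"
    "\<And>f::complex \<Rightarrow> complex. (\<Sum>z\<in>Z. of_nat (m z) * f z) = (\<Sum>x\<leftarrow>xs. f x)" by blast
  then show ?case using insert.hyps
    by (intro exI[of _ "replicate (m z) z @ xs"]) (auto simp: sum_list_replicate)
qed auto

section \<open>Zeros of a holomorphic family in a disc\<close>

definition hol_family ::
  "(complex \<Rightarrow> 'w::topological_space) set \<Rightarrow> 'w set \<Rightarrow> real \<Rightarrow> ('w \<Rightarrow> complex \<Rightarrow> complex) \<Rightarrow> bool" where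
  "hol_family L D R g \<longleftrightarrow> continuous_on (D \<times> ball 0 R) (\<lambda>(w,s). g w s) \<and>
     (\<forall>s\<in>ball 0 R. hol_along L D (\<lambda>w. g w s)) \<and> (\<forall>w\<in>D. g w holomorphic_on ball 0 R)"

lemma hol_family_cont:
  assumes "hol_family L D R g" "continuous_on T p" "continuous_on T q" "p ` T \<subseteq> D" "q ` T \<subseteq> ball 0 R"
  shows "continuous_on T (\<lambda>x. g (p x) (q x))"
proof -
  have "continuous_on T (\<lambda>x. (\<lambda>(w,s). g w s) (p x, q x))"
    by (rule continuous_on_compose2[of "D \<times> ball 0 R"])
      (use assms in \<open>auto simp: hol_family_def intro!: continuous_intros\<close>)
  then show ?thesis by simp
qed

text \<open>Cauchy's formula writes the derivative in \<open>s\<close> as a contour integral of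
  \<open>g\<close>, which settles its dependence on \<open>w\<close>. The circle has radius
  \<open>r\<close>, whence the smaller disc in the conclusion.\<close>

lemma hol_family_deriv:
  fixes g :: "'w::topological_space \<Rightarrow> complex \<Rightarrow> complex"
  assumes L: "open_along L D" and g: "hol_family L D R g" and r: "0 < r" "r < R"
  shows "hol_family L D r (\<lambda>w. deriv (g w))"
proof -
  define dg where "dg w s = contour_integral (circlepath 0 r) (\<lambda>u. g w u / (u - s)^2) / (2 * pi * \<i>)" for w s
  have eq: "dg w s = deriv (g w) s" if "w \<in> D" "s \<in> ball 0 r" for w s
  proof -
    have h: "g w holomorphic_on ball 0 R" using g that by (auto simp: hol_family_def)
    have "contour_integral (circlepath 0 r) (\<lambda>u. g w u / (u - s)^2) = (2 * pi * \<i>) * deriv (g w) s"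
      using that r by (intro Cauchy_contour_integral_circlepath_2)
         (auto intro!: holomorphic_on_imp_continuous_on holomorphic_on_subset[OF h])
    then show ?thesis by (simp add: dg_def)
  qed
  have "continuous_on (D \<times> ball 0 r) (\<lambda>p. contour_integral (circlepath 0 r) (\<lambda>u. g (fst p) u / (u - snd p)^2))"
  proof (rule continuous_on_contour_integral_param)
    show "continuous_on ((D \<times> ball 0 r) \<times> sphere 0 r) (\<lambda>(p,u). g (fst p) u / (u - snd p)^2)"
      unfolding case_prod_unfold using r
      by (intro continuous_intros hol_family_cont[OF g]) auto
  qed (use r in auto)
  then have "continuous_on (D \<times> ball 0 r) (\<lambda>(w,s). dg w s)"
    unfolding dg_def case_prod_unfold by (intro continuous_intros) auto
  then have 1: "continuous_on (D \<times> ball 0 r) (\<lambda>(w,s). deriv (g w) s)"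
    by (rule continuous_on_eq) (auto simp: eq)
  have 2: "hol_along L D (\<lambda>w. deriv (g w) s)" if s: "s \<in> ball 0 r" for s
  proof -
    have "hol_along L D (\<lambda>w. contour_integral (circlepath 0 r) (\<lambda>u. g w u / (u - s)^2))"
    proof (rule hol_along_contour_integral[OF L])
      show "continuous_on (D \<times> sphere 0 r) (\<lambda>(w,u). g w u / (u - s)^2)"
        unfolding case_prod_unfold using r s
        by (intro continuous_intros hol_family_cont[OF g]) auto
      show "hol_along L D (\<lambda>w. g w u / (u - s)^2)" if "norm u = r" for u
        using g r s that by (intro hol_along_divide) (auto simp: hol_family_def)
    qed (use r in auto)
    then have "hol_along L D (\<lambda>w. dg w s)"
      unfolding dg_def by (intro hol_along_divide) auto
    then show ?thesis using eq s
      by (auto simp: hol_along_def elim!: continuous_on_eq holomorphic_transform)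
  qed
  have 3: "deriv (g w) holomorphic_on ball 0 r" if "w \<in> D" for w
    using g r that by (intro holomorphic_deriv) (auto simp: hol_family_def intro: holomorphic_on_subset)
  from 1 2 3 show ?thesis by (auto simp: hol_family_def)
qed

text \<open>Weighted argument principle. One list \<open>xs\<close> has to serve all
  \<open>k\<close>, since Newton's identities combine power sums of the same numbers.\<close>

lemma power_sums_of_zeros:
  assumes g: "g holomorphic_on ball 0 R" and h: "h holomorphic_on ball 0 R" and r: "0 < r" "r < R"
    and nz: "\<And>s. norm s = r \<Longrightarrow> g s \<noteq> 0"
  shows "\<exists>xs. set xs = {s\<in>ball 0 r. g s = 0} \<and>
    (\<forall>k. contour_integral (circlepath 0 r) (\<lambda>s. deriv g s * h s ^ k / g s) / (2 * pi * \<i>) = (\<Sum>x\<leftarrow>xs. h x ^ k))"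
proof -
  \<comment> \<open>The open ball of radius \<open>R\<close> may contain infinitely many zeros;
    those in the ball of radius \<open>R'\<close> lie in a compact subset of it.\<close>
  define R' where "R' = (r + R) / 2"
  have R': "r < R'" "R' < R" "0 < R'" using r by (auto simp: R'_def)
  let ?S = "ball 0 R' :: complex set" 
  define Z where "Z = {s\<in>?S. g s = 0}"
  have gS: "g holomorphic_on ?S" and hS: "h holomorphic_on ?S" using g h R' by (auto intro: holomorphic_on_subset)
  have nc: "\<not> g constant_on ball 0 R" if "s \<in> ball 0 R" "g s = 0" for s
  proof -
    have "g (of_real r) \<noteq> 0" "of_real r \<in> ball (0::complex) R" using nz r by auto
    then show ?thesis using that unfolding constant_on_def by metis
  qed
  have fin: "finite Z"
  proof (cases "Z = {}")
    case False
    then obtain s where "s \<in> Z" by auto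
    then have "\<not> g constant_on ball 0 R" using nc[of s] R' by (auto simp: Z_def)
    then have "finite {z\<in>cball 0 R'. g z = 0}"
      using R' by (intro holomorphic_compact_finite_zeros[OF g]) auto
    then show ?thesis by (rule rev_finite_subset) (auto simp: Z_def)
  qed auto
  have pos: "zorder g s > 0" if s: "s \<in> Z" for s
  proof -
    have "\<exists>w\<in>?S. g w \<noteq> 0" using nz[of "of_real r"] r R' by (intro bexI[of _ "of_real r"]) auto
    then show ?thesis using zorder_exist_zero[OF gS _ _ _ ] s by (auto simp: Z_def)
  qed
  \<comment> \<open>Zeros of norm above \<open>r\<close> get weight 0, in accordance with their
    winding number, and drop out of \<open>xs\<close>.\<close>
  define m where "m s = (if norm s < r then nat (zorder g s) else 0)" for s
  obtain xs where xs: "set xs = {z\<in>Z. m z > 0}"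
    and sum: "\<And>f::complex \<Rightarrow> complex. (\<Sum>z\<in>Z. of_nat (m z) * f z) = (\<Sum>x\<leftarrow>xs. f x)"
    using weighted_sum_as_list[OF fin] by blast
  have "set xs = {s\<in>ball 0 r. g s = 0}"
    using xs pos R' by (auto simp: m_def Z_def)
  moreover have "contour_integral (circlepath 0 r) (\<lambda>s. deriv g s * h s ^ k / g s) / (2 * pi * \<i>) = (\<Sum>x\<leftarrow>xs. h x ^ k)" for k
  proof -
    have pimage: "path_image (circlepath 0 r) \<subseteq> ?S - Z" using r R' nz by (auto simp: Z_def)
    have "contour_integral (circlepath 0 r) (\<lambda>s. deriv g s * h s ^ k / g s) = 2 * pi * \<i> *
          (\<Sum>p\<in>{w\<in>?S. g w = 0 \<or> w \<in> {}}. winding_number (circlepath 0 r) p * h p ^ k * zorder g p)"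
    proof (rule argument_principle)
      show "\<forall>z. z \<notin> ?S \<longrightarrow> winding_number (circlepath 0 r) z = 0"
      proof safe
        fix z assume z: "z \<notin> ?S"
        show "winding_number (circlepath 0 r) z = 0"
          by (rule winding_number_zero_outside[of _ "cball 0 r"]) (use z r R' in auto)
      qed
    qed (use gS hS pimage fin in \<open>auto simp: Z_def intro!: holomorphic_intros\<close>)
    also have "(\<Sum>p\<in>{w\<in>?S. g w = 0 \<or> w \<in> {}}. winding_number (circlepath 0 r) p * h p ^ k * zorder g p)
       = (\<Sum>p\<in>Z. of_nat (m p) * h p ^ k)"
    proof (rule sum.cong)
      fix p assume p: "p \<in> Z"
      have "winding_number (circlepath 0 r) p = (if norm p < r then 1 else 0)"
      proof (cases "norm p < r")
        case True then show ?thesis by (simp add: winding_number_circlepath)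
      next
        case False
        moreover have "norm p \<noteq> r" using p nz[of p] by (auto simp: Z_def)
        ultimately have "norm p > r" by simp
        then show ?thesis using r
          by (simp, intro winding_number_zero_outside[of _ "cball 0 r"]) auto
      qed
      then show "winding_number (circlepath 0 r) p * h p ^ k * zorder g p = of_nat (m p) * h p ^ k"
        using pos[OF p] by (simp add: m_def)
    qed (auto simp: Z_def)
    also have "\<dots> = (\<Sum>x\<leftarrow>xs. h x ^ k)" by (rule sum)
    finally show ?thesis by simp
  qed
  ultimately show ?thesis by blast
qed

text \<open>F is the product of the values of h at the zeros of g, counted with multiplicity. It is
  holomorphic because Newton's recursion expresses it through the power sums of these values, which are
  contour integrals by the argument principle.\<close>
lemma eliminate_variable:
  fixes g h :: "'w::topological_space \<Rightarrow> complex \<Rightarrow> complex"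
  assumes L: "open_along L D" and D: "connected D" and r: "0 < r" "r < R"
    and g: "hol_family L D R g" and h: "hol_family L D R h"
    and nz: "\<And>w s. w \<in> D \<Longrightarrow> norm s = r \<Longrightarrow> g w s \<noteq> 0"
  shows "\<exists>F. hol_along L D F \<and> (\<forall>w\<in>D. F w = 0 \<longleftrightarrow> (\<exists>s\<in>ball 0 r. g w s = 0 \<and> h w s = 0))"
proof -
  define p where "p k w = contour_integral (circlepath 0 r) (\<lambda>s. deriv (g w) s * h w s ^ k / g w s) / (2 * pi * \<i>)" for k w
  define R' where "R' = (r + R) / 2"
  have R': "r < R'" "R' < R" "0 < R'" using r by (auto simp: R'_def)
  have dg: "hol_family L D R' (\<lambda>w. deriv (g w))" by (rule hol_family_deriv[OF L g]) (use R' in auto)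
  have p: "hol_along L D (p k)" for k
  proof -
    have "hol_along L D (\<lambda>w. contour_integral (circlepath 0 r) (\<lambda>s. deriv (g w) s * h w s ^ k / g w s))"
    proof (rule hol_along_contour_integral[OF L])
      show "continuous_on (D \<times> sphere 0 r) (\<lambda>(w, s). deriv (g w) s * h w s ^ k / g w s)"
        unfolding case_prod_unfold using r nz R'
        by (intro continuous_intros hol_family_cont[OF g] hol_family_cont[OF h] hol_family_cont[OF dg]) auto
      show "hol_along L D (\<lambda>w. deriv (g w) s * h w s ^ k / g w s)" if "norm s = r" for s
        using g h dg r R' that nz
        by (intro hol_along_divide hol_along_mult hol_along_power) (auto simp: hol_family_def)
    qed (use r in auto)
    then show ?thesis unfolding p_def by (intro hol_along_divide) auto
  qed
  have "\<forall>w\<in>D. \<exists>xs. set xs = {s\<in>ball 0 r. g w s = 0} \<and> (\<forall>k. p k w = (\<Sum>x\<leftarrow>xs. h w x ^ k))"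
    using power_sums_of_zeros[of _ R _ r] g h r nz unfolding p_def hol_family_def by blast
  then obtain xs where xs: "\<And>w. w \<in> D \<Longrightarrow> set (xs w) = {s\<in>ball 0 r. g w s = 0}"
    and px: "\<And>w k. w \<in> D \<Longrightarrow> p k w = (\<Sum>x\<leftarrow>xs w. h w x ^ k)" by metis
  have p0: "p 0 w = of_nat (length (xs w))" if "w \<in> D" for w
    using px[OF that, of 0] by (simp add: sum_list_triv)
  \<comment> \<open>\<open>p 0\<close> counts the zeros with multiplicity. Continuous and
    integer-valued on a connected set, it is constant, so Newton's recursion at one index
    \<open>d\<close> gives the product over the fibre at every \<open>w\<close>.\<close>
  have "p 0 constant_on D"
  proof (rule continuous_discrete_range_constant[OF D])
    show "continuous_on D (p 0)" using p[of 0] by (simp add: hol_along_def)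
    fix w assume w: "w \<in> D"
    show "\<exists>e>0. \<forall>y. y \<in> D \<and> p 0 y \<noteq> p 0 w \<longrightarrow> e \<le> norm (p 0 y - p 0 w)"
    proof (intro exI[of _ 1] conjI allI impI)
      fix y assume y: "y \<in> D \<and> p 0 y \<noteq> p 0 w"
      have "p 0 y - p 0 w = of_int (int (length (xs y)) - int (length (xs w)))" using y w by (simp add: p0)
      moreover have "int (length (xs y)) - int (length (xs w)) \<noteq> 0" using y w by (auto simp: p0)
      ultimately show "1 \<le> norm (p 0 y - p 0 w)"
        by (metis norm_of_int of_int_abs of_int_1_le_iff zabs_less_one_iff not_less)
    qed simp
  qed
  then obtain d where d: "\<And>w. w \<in> D \<Longrightarrow> length (xs w) = d"
    unfolding constant_on_def using p0 by (metis of_nat_eq_iff)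
  define F where "F w = newton (\<lambda>k. p k w) d" for w
  have "hol_along L D (\<lambda>w. newton (\<lambda>k. p k w) n)" for n
  proof (induction n rule: less_induct)
    case (less n)
    then show ?case
      by (cases n) (auto intro!: hol_along_divide hol_along_sum hol_along_mult p simp del: of_nat_Suc)
  qed
  moreover have "F w = 0 \<longleftrightarrow> (\<exists>s\<in>ball 0 r. g w s = 0 \<and> h w s = 0)" if w: "w \<in> D" for w
  proof -
    have "F w = newton (\<lambda>k. \<Sum>x\<leftarrow>map (h w) (xs w). x ^ k) (length (map (h w) (xs w)))"
      by (simp add: F_def px[OF w] d[OF w] o_def)
    also have "\<dots> = prod_list (map (h w) (xs w))" by (rule newton_power_sums)
    finally show ?thesis using xs[OF w] by (auto simp: prod_list_zero_iff image_iff)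
  qed
  ultimately show ?thesis unfolding F_def by blast
qed

section \<open>Polydiscs over complex subspaces\<close>

lemma norm_vector_scalar_mult: "norm (c *s x) = norm c * norm x" for x :: "complex^'n"
  by (simp add: norm_vec_def norm_mult L2_set_right_distrib)

lemma bounded_bilinear_vector_scalar_mult:
  "bounded_bilinear ((*s) :: complex \<Rightarrow> complex^'n \<Rightarrow> complex^'n)"
proof
  show "\<exists>K. \<forall>a b. norm (a *s (b::complex^'n)) \<le> norm a * norm b * K"
    by (rule exI[of _ 1]) (simp add: norm_vector_scalar_mult)
qed (simp_all add: vec_eq_iff algebra_simps)

lemmas continuous_on_vector_scalar_mult [continuous_intros] =
  bounded_bilinear.continuous_on[OF bounded_bilinear_vector_scalar_mult]

lemma scaleR_eq_vector_scalar_mult: "a *\<^sub>R x = of_real a *s x" for x :: "complex^'n"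
  by (simp add: vec_eq_iff scaleR_conv_of_real[where 'a = complex])

text \<open>A ball of \<open>S\<close> times a disc in t. Letting \<open>S\<close> shrink inside a
  fixed type of vectors makes an induction on dimension possible.\<close>

definition polydisc :: "(complex^'n) set \<Rightarrow> real \<Rightarrow> ((complex^'n) \<times> complex) set" where
  "polydisc S r = {p. fst p \<in> S \<and> norm (fst p) < r \<and> norm (snd p) < r}"

definition lines :: "(complex^'n) set \<Rightarrow> (complex \<Rightarrow> (complex^'n) \<times> complex) set" where
  "lines S = {l. \<exists>a\<in>S. \<exists>b\<in>S. \<exists>s t. l = (\<lambda>x. (a + x *s b, s + x * t))}"

lemma hol_along_lines:
  "hol_along (lines S) D f \<longleftrightarrow> continuous_on D f \<and>
    (\<forall>a\<in>S. \<forall>b\<in>S. \<forall>s t. (\<lambda>x. f (a + x *s b, s + x * t)) holomorphic_on {x. (a + x *s b, s + x * t) \<in> D})"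
proof -
  have "(\<forall>l\<in>lines S. P l) \<longleftrightarrow> (\<forall>a\<in>S. \<forall>b\<in>S. \<forall>s t. P (\<lambda>x. (a + x *s b, s + x * t)))" for P
    unfolding lines_def by fast
  then show ?thesis by (simp add: hol_along_def vimage_def)
qed

lemma polydisc_mono: "r \<le> r' \<Longrightarrow> S \<subseteq> S' \<Longrightarrow> polydisc S r \<subseteq> polydisc S' r'"
  by (auto simp: polydisc_def)

lemma open_along_lines:
  assumes "vec.subspace S"
  shows "open_along (lines S) (polydisc S r)"
  unfolding open_along_def
proof
  fix l assume "l \<in> lines S"
  then obtain a b s t where l: "l = (\<lambda>x. (a + x *s b, s + x * t))" and ab: "a \<in> S" "b \<in> S"
    by (auto simp: lines_def)
  have "l -` polydisc S r = {x. norm (a + x *s b) < r} \<inter> {x. norm (s + x * t) < r}"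
    using assms ab by (auto simp: l polydisc_def vec.subspace_add vec.subspace_scale)
  also have "open \<dots>"
    by (intro open_Int open_Collect_less continuous_intros)
  finally show "continuous_on UNIV l \<and> open (l -` polydisc S r)"
    unfolding l by (auto intro!: continuous_intros)
qed

lemma connected_polydisc:
  assumes "vec.subspace S"
  shows "connected (polydisc S r)"
proof -
  have "subspace S"
    using assms by (auto simp: subspace_def vec.subspace_def scaleR_eq_vector_scalar_mult)
  moreover have "polydisc S r = (S \<inter> ball 0 r) \<times> ball 0 r"
    by (auto simp: polydisc_def)
  ultimately show ?thesis
    by (simp only: convex_connected convex_Times convex_Int subspace_imp_convex convex_ball)
qed

section \<open>Dividing by a power of t\<close>

lemma finite_vanishing_order:
  fixes f :: "complex \<Rightarrow> complex"
  assumes f: "f holomorphic_on ball 0 r" and t0: "t0 \<in> ball 0 r" "f t0 \<noteq> 0"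
  shows "\<exists>n. \<not> (\<exists>h. h holomorphic_on ball 0 r \<and> (\<forall>t\<in>ball 0 r. f t = t ^ n * h t))"
proof (rule ccontr)
  assume "\<not> ?thesis"
  then have all: "\<And>n. \<exists>h. h holomorphic_on ball 0 r \<and> (\<forall>t\<in>ball 0 r. f t = t ^ n * h t)" by blast
  have r: "r > 0" using t0 by (auto intro: le_less_trans[OF norm_ge_zero])
  have f0: "f 0 = 0" using all[of 1] r by auto
  have nc: "\<not> f constant_on ball 0 r" using f0 t0 r
    unfolding constant_on_def by (metis centre_in_ball)
  obtain g e n where g: "0 < n" "0 < e" "ball (0::complex) e \<subseteq> ball 0 r" "g holomorphic_on ball 0 e"
     "\<And>w. w \<in> ball 0 e \<Longrightarrow> f w = (w - 0) ^ n * g w" "\<And>w. w \<in> ball 0 e \<Longrightarrow> g w \<noteq> 0"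
    by (rule holomorphic_factor_zero_nonconstant[OF f open_ball connected_ball _ f0 nc]) (use r in simp, rule that, assumption+)
  \<comment> \<open>\<open>n\<close> is the order of the zero at 0 and \<open>g\<close> the
    nonvanishing cofactor; divisibility by \<open>t ^ Suc n\<close> would force
    \<open>g 0 = 0\<close>.\<close>
  obtain h where h: "h holomorphic_on ball 0 r" "\<And>t. t \<in> ball 0 r \<Longrightarrow> f t = t ^ Suc n * h t"
    using all by blast
  have eq: "g w = w * h w" if "w \<in> ball 0 e" "w \<noteq> 0" for w
  proof -
    have "w ^ n * g w = w ^ n * (w * h w)" using g(5)[OF that(1)] h(2)[of w] g(3) that(1) by auto
    then show ?thesis using that(2) by simp
  qed
  have "(\<lambda>w. g w - w * h w) \<midarrow>0\<rightarrow> g 0 - 0 * h 0"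
    using g h r
    by (intro tendsto_intros) (metis centre_in_ball continuous_on_interior holomorphic_on_imp_continuous_on interior_ball isCont_def open_ball interior_open)+
  moreover have "eventually (\<lambda>w. w \<in> ball 0 e) (at (0::complex))"
    using g by (intro eventually_at_in_open') auto
  then have "eventually (\<lambda>w. g w - w * h w = 0) (at 0)"
    using eventually_neq_at_within[of 0] by eventually_elim (simp add: eq)
  ultimately have "(\<lambda>w::complex. 0) \<midarrow>0\<rightarrow> g 0 - 0 * h 0"
    by (rule Lim_transform_eventually)
  then have "g 0 = 0" by (simp add: tendsto_const_iff)
  then show False using g by auto
qed

text \<open>\<open>k\<close> is the largest power of t dividing every slice of \<open>g\<close> at
  fixed \<open>z\<close>, and the \<open>z\<close> of the conclusion marks a slice that no higher
  power divides. The quotients of single slices are holomorphic in t only; Cauchy's formula on a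
  fixed circle makes them holomorphic in all variables together.\<close>

lemma divide_by_power:
  fixes S :: "(complex^'n) set"
  assumes S: "vec.subspace S" and g: "hol_along (lines S) (polydisc S r) g"
    and p: "p \<in> polydisc S r" "g p \<noteq> 0"
  shows "\<exists>\<rho> k q z. 0 < \<rho> \<and> \<rho> < r \<and> hol_along (lines S) (polydisc S \<rho>) q \<and>
     (\<forall>z t. (z,t) \<in> polydisc S \<rho> \<longrightarrow> g (z,t) = t ^ k * q (z,t)) \<and> z \<in> S \<and> norm z < \<rho> \<and> q (z, 0) \<noteq> 0"
proof -
  have r: "r > 0" using p by (auto simp: polydisc_def intro: le_less_trans[OF norm_ge_zero])
  define dv where "dv k z \<longleftrightarrow> (\<exists>h. h holomorphic_on ball 0 r \<and> (\<forall>t\<in>ball 0 r. g (z,t) = t ^ k * h t))" for k z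
  let ?Q = "\<lambda>k. \<forall>z\<in>S. norm z < r \<longrightarrow> dv k z"
  have gz: "(\<lambda>t. g (z,t)) holomorphic_on ball 0 r" if "z \<in> S" "norm z < r" for z
  proof -
    have "(\<lambda>x. g (z + x *s 0, 0 + x * 1)) holomorphic_on {x. (z + x *s 0, 0 + x * 1) \<in> polydisc S r}"
      using g that S unfolding hol_along_lines by (blast intro: vec.subspace_0)
    moreover have "{x. (z + x *s 0, 0 + x * 1) \<in> polydisc S r} = ball 0 r"
      using that by (auto simp: polydisc_def)
    ultimately show ?thesis by simp
  qed
  have Q0: "?Q 0" using gz by (auto simp: dv_def)
  \<comment> \<open>The slice through \<open>p\<close> is not identically zero, so some power of t
    does not divide it and \<open>k\<close> exists.\<close>
  obtain n where "\<not> dv n (fst p)"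
    using finite_vanishing_order[OF gz[of "fst p"], of "snd p"] p unfolding dv_def by (auto simp: polydisc_def)
  then have "\<not> ?Q n" using p by (auto simp: polydisc_def)
  obtain k where k: "?Q k" "\<not> ?Q (Suc k)"
  proof (rule ccontr)
    assume no: "\<not> thesis"
    have "?Q m" for m
    proof (induction m)
      case (Suc m)
      then show ?case using no that by blast
    qed (rule Q0)
    with \<open>\<not> ?Q n\<close> show False by blast
  qed
  then obtain z1 where z1: "z1 \<in> S" "norm z1 < r" "\<not> dv (Suc k) z1" by blast
  obtain H where H: "\<And>z. z \<in> S \<Longrightarrow> norm z < r \<Longrightarrow> H z holomorphic_on ball 0 r"
    "\<And>z t. z \<in> S \<Longrightarrow> norm z < r \<Longrightarrow> t \<in> ball 0 r \<Longrightarrow> g (z,t) = t ^ k * H z t"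
    using k(1) unfolding dv_def by metis
  have H0: "H z1 0 \<noteq> 0"
  proof
    assume 0: "H z1 0 = 0"
    define h where "h t = (if t = 0 then deriv (H z1) 0 else (H z1 t - H z1 0) / (t - 0))" for t
    have "h holomorphic_on ball 0 r" unfolding h_def using H(1)[OF z1(1,2)] by (rule pole_lemma_open) simp
    moreover have "g (z1,t) = t ^ Suc k * h t" if "t \<in> ball 0 r" for t
      using H(2)[OF z1(1,2) that] 0 by (auto simp: h_def)
    ultimately show False using z1(3) unfolding dv_def by blast
  qed
  \<comment> \<open>The midpoints keep \<open>z1\<close> within radius \<open>\<rho>\<close> and the
    circle of radius \<open>R\<close> strictly between \<open>\<rho>\<close> and
    \<open>r\<close>.\<close>
  define \<rho> where "\<rho> = (r + norm z1) / 2"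
  define R where "R = (r + \<rho>) / 2"
  have \<rho>: "0 < \<rho>" "\<rho> < R" "R < r" "norm z1 < \<rho>" "\<rho> < r" "0 < R"
    using z1 r norm_ge_zero[of z1] by (auto simp: \<rho>_def R_def field_simps simp del: norm_ge_zero)
  define q where "q w = contour_integral (circlepath 0 R) (\<lambda>u. g (fst w, u) / (u ^ k * (u - snd w))) / (2 * pi * \<i>)" for w
  have qH: "q (z,t) = H z t" if "(z,t) \<in> polydisc S \<rho>" for z t
  proof -
    have zt: "z \<in> S" "norm z < r" "norm t < R" using that \<rho> by (auto simp: polydisc_def)
    have "H z holomorphic_on cball 0 R" using H(1)[OF zt(1,2)] \<rho> by (auto intro: holomorphic_on_subset)
    then have "contour_integral (circlepath 0 R) (\<lambda>u. H z u / (u - t)) = 2 * pi * \<i> * H z t"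
      using contour_integral_unique[OF Cauchy_integral_circlepath_simple, of "H z" 0 R t] zt by simp
    moreover have "contour_integral (circlepath 0 R) (\<lambda>u. H z u / (u - t))
      = contour_integral (circlepath 0 R) (\<lambda>u. g (z, u) / (u ^ k * (u - t)))"
      by (rule contour_integral_cong) (use \<rho> H(2)[OF zt(1,2)] in auto)
    ultimately show ?thesis by (simp add: q_def)
  qed
  have "hol_along (lines S) (polydisc S \<rho>)
      (\<lambda>w. contour_integral (circlepath 0 R) (\<lambda>u. g (fst w, u) / (u ^ k * (u - snd w))))"
  proof (rule hol_along_contour_integral[OF open_along_lines[OF S]])
    show "continuous_on (polydisc S \<rho> \<times> sphere 0 R) (\<lambda>(w, u). g (fst w, u) / (u ^ k * (u - snd w)))"
      unfolding case_prod_unfold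
    proof (intro continuous_intros)
      show "continuous_on (polydisc S \<rho> \<times> sphere 0 R) (\<lambda>x. g (fst (fst x), snd x))"
        by (rule continuous_on_compose2[of "polydisc S r" g])
          (use g \<rho> in \<open>auto simp: hol_along_def polydisc_def intro!: continuous_intros\<close>)
    qed (use \<rho> in \<open>auto simp: polydisc_def\<close>)
    show "hol_along (lines S) (polydisc S \<rho>) (\<lambda>w. g (fst w, u) / (u ^ k * (u - snd w)))" if u: "norm u = R" for u
    proof (rule hol_along_divide)
      show "u ^ k * (u - snd w) \<noteq> 0" if "w \<in> polydisc S \<rho>" for w
        using u \<rho> that by (auto simp: polydisc_def)
      show "hol_along (lines S) (polydisc S \<rho>) (\<lambda>w. u ^ k * (u - snd w))"
        unfolding hol_along_lines by (auto intro!: continuous_intros holomorphic_intros)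
      show "hol_along (lines S) (polydisc S \<rho>) (\<lambda>w. g (fst w, u))"
        unfolding hol_along_lines
      proof (intro conjI ballI allI)
        show "continuous_on (polydisc S \<rho>) (\<lambda>w. g (fst w, u))"
          by (rule continuous_on_compose2[of "polydisc S r" g])
            (use g \<rho> u in \<open>auto simp: hol_along_def polydisc_def intro!: continuous_intros\<close>)
        fix a b s t assume ab: "a \<in> S" "b \<in> S"
        have "(\<lambda>x. g (a + x *s b, u + x * 0)) holomorphic_on {x. (a + x *s b, u + x * 0) \<in> polydisc S r}"
          using g ab unfolding hol_along_lines by blast
        then show "(\<lambda>x. g (fst (a + x *s b, s + x * t), u)) holomorphic_on {x. (a + x *s b, s + x * t) \<in> polydisc S \<rho>}"
          using \<rho> u by (auto simp: polydisc_def elim!: holomorphic_on_subset)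
      qed
    qed
  qed (use \<rho> in auto)
  then have "hol_along (lines S) (polydisc S \<rho>) q"
    unfolding q_def by (intro hol_along_divide) auto
  moreover have "g (z,t) = t ^ k * q (z,t)" if "(z,t) \<in> polydisc S \<rho>" for z t
    using that H(2)[of z t] \<rho> qH[OF that] by (auto simp: polydisc_def)
  moreover have "q (z1, 0) \<noteq> 0" using qH[of z1 0] H0 z1 \<rho> by (auto simp: polydisc_def)
  ultimately show ?thesis using \<rho> z1 by blast
qed

text \<open>Coordinates for the projection along \<open>e\<close>: a base point over
  \<open>S'\<close> and the coordinate \<open>s\<close> on the fibre. The bound on the radii is the
  triangle inequality for \<open>z + s *s e\<close>.\<close>

lemma hol_family_translate:
  fixes S :: "(complex^'n) set"
  assumes S: "vec.subspace S" "S' \<subseteq> S" "e \<in> S" and f: "hol_along (lines S) (polydisc S r) f"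
    and R: "\<sigma> + R * norm e \<le> r" "R > 0" "\<sigma> \<le> r"
  shows "hol_family (lines S') (polydisc S' \<sigma>) R (\<lambda>w s. f (fst w + s *s e, snd w))"
proof -
  have dom: "(z + s *s e, t) \<in> polydisc S r" if "(z,t) \<in> polydisc S' \<sigma>" "norm s < R" for z t s
  proof -
    have "norm (z + s *s e) \<le> norm z + norm s * norm e"
      by (metis norm_triangle_ineq norm_vector_scalar_mult)
    also have "\<dots> < \<sigma> + R * norm e"
      using that by (intro add_less_le_mono mult_right_mono) (auto simp: polydisc_def)
    finally show ?thesis
      using that S R by (auto simp: polydisc_def intro!: vec.subspace_add vec.subspace_scale)
  qed
  have fc: "continuous_on (polydisc S r) f" using f by (simp add: hol_along_def)
  have fl: "(\<lambda>x. f (a + x *s b, s + x * t)) holomorphic_on X"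
    if "a \<in> S" "b \<in> S" "\<And>x. x \<in> X \<Longrightarrow> (a + x *s b, s + x * t) \<in> polydisc S r" for a b s t X
    by (rule holomorphic_on_subset[of _ "{x. (a + x *s b, s + x * t) \<in> polydisc S r}"])
      (use f that in \<open>auto simp: hol_along_lines\<close>)
  show ?thesis
    unfolding hol_family_def
  proof (intro conjI ballI)
    show "continuous_on (polydisc S' \<sigma> \<times> ball 0 R) (\<lambda>(w, s). f (fst w + s *s e, snd w))"
      unfolding case_prod_unfold
      by (rule continuous_on_compose2[OF fc]) (use dom in \<open>auto intro!: continuous_intros\<close>)
    fix s :: complex assume s: "s \<in> ball 0 R"
    show "hol_along (lines S') (polydisc S' \<sigma>) (\<lambda>w. f (fst w + s *s e, snd w))"
      unfolding hol_along_lines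
    proof (intro conjI ballI allI)
      show "continuous_on (polydisc S' \<sigma>) (\<lambda>w. f (fst w + s *s e, snd w))"
        by (rule continuous_on_compose2[OF fc]) (use dom s in \<open>auto intro!: continuous_intros\<close>)
      fix a b u t assume ab: "a \<in> S'" "b \<in> S'"
      let ?X = "{x. (a + x *s b, u + x * t) \<in> polydisc S' \<sigma>}"
      have eq: "a + x *s b + s *s e = (a + s *s e) + x *s b" for x by simp
      have "(\<lambda>x. f ((a + s *s e) + x *s b, u + x * t)) holomorphic_on ?X"
        by (rule fl) (use ab S dom s in \<open>auto simp flip: eq intro!: vec.subspace_add vec.subspace_scale\<close>)
      then show "(\<lambda>x. f (fst (a + x *s b, u + x * t) + s *s e, snd (a + x *s b, u + x * t))) holomorphic_on ?X"
        by (simp add: eq)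
    qed
  next
    fix w assume w: "w \<in> polydisc S' \<sigma>"
    have "(\<lambda>x. f (fst w + x *s e, snd w + x * 0)) holomorphic_on ball 0 R"
      by (rule fl) (use w S dom in \<open>auto simp: polydisc_def\<close>)
    then show "(\<lambda>s. f (fst w + s *s e, snd w)) holomorphic_on ball 0 R" by simp
  qed
qed

section \<open>Fibres of an analytic set over a disc\<close>

inductive_set combinations :: "('w \<Rightarrow> complex) set \<Rightarrow> ('w \<Rightarrow> complex) set" for G where
  base: "g \<in> G \<Longrightarrow> g \<in> combinations G"
| add: "a \<in> combinations G \<Longrightarrow> b \<in> combinations G \<Longrightarrow> (\<lambda>w. a w + c * b w) \<in> combinations G"

lemma hol_along_combinations:
  assumes "h \<in> combinations G" "\<And>g. g \<in> G \<Longrightarrow> hol_along L D g"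
  shows "hol_along L D h"
  using assms(1)
proof induction
  case (add a b c)
  then show ?case by (intro hol_along_add hol_along_mult hol_along_const)
qed (rule assms(2))

lemma combinations_vanish:
  assumes "h \<in> combinations G" "\<And>g. g \<in> G \<Longrightarrow> g w = 0"
  shows "h w = 0"
  using assms by induction auto

text \<open>When a new \<open>g\<close> is added, each point excludes at most one coefficient
  \<open>c\<close>, and finitely many values do not exhaust the complex numbers.\<close>

lemma combination_avoids_zeros:
  assumes "finite Z" "G \<noteq> {}" "\<And>z. z \<in> Z \<Longrightarrow> \<exists>g\<in>G. g z \<noteq> 0"
  shows "\<exists>h\<in>combinations G. \<forall>z\<in>Z. h z \<noteq> 0"
  using assms(1,3)
proof (induction Z)
  case empty
  then show ?case using assms(2) by (auto intro: combinations.base)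
next
  case (insert z0 Z)
  then obtain h where h: "h \<in> combinations G" "\<And>z. z \<in> Z \<Longrightarrow> h z \<noteq> 0" by auto
  obtain g where g: "g \<in> G" "g z0 \<noteq> 0" using insert.prems by auto
  \<comment> \<open>Where \<open>g z = 0\<close> the quotient is 0 by convention. This excludes the
    coefficient 0 as well, harmlessly, because such points keep the value
    \<open>h z\<close>.\<close>
  obtain c where c: "c \<notin> (\<lambda>z. - h z / g z) ` insert z0 Z"
    using ex_new_if_finite[OF infinite_UNIV_char_0 finite_imageI[of "insert z0 Z" "\<lambda>z. - h z / g z"]]
      insert.hyps by auto
  have "h z + c * g z \<noteq> 0" if "z \<in> insert z0 Z" for z
  proof (cases "g z = 0")
    case True
    then show ?thesis using that g h by auto
  next
    case False
    have "c \<noteq> - h z / g z" using c that by blast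
    then show ?thesis using False by (auto simp: field_simps add_eq_0_iff)
  qed
  then show ?case
    using combinations.add[OF h(1) combinations.base[OF g(1)], of c] by (intro bexI) auto
qed

text \<open>Induction on the dimension of S: divide one g in G by a power of t so that it does not vanish
  identically on t = 0, and project along a direction e on which the quotient is not identically zero.
  The family G' cuts out the image of the common zeros.\<close>
lemma fibres_near_origin:
  fixes S :: "(complex^'n) set"
  assumes "vec.subspace S" "r > 0" "\<And>g. g \<in> G \<Longrightarrow> hol_along (lines S) (polydisc S r) g"
    and "\<And>\<epsilon>. \<epsilon> > 0 \<Longrightarrow> \<exists>p\<in>polydisc S \<epsilon>. snd p \<noteq> 0 \<and> (\<forall>g\<in>G. g p = 0)" and "\<epsilon> > 0"
  shows "\<exists>\<delta>>0. \<forall>t. t \<noteq> 0 \<and> norm t < \<delta> \<longrightarrow> (\<exists>z\<in>S. norm z < \<epsilon> \<and> (\<forall>g\<in>G. g (z,t) = 0))"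
  using assms
proof (induction "vec.dim S" arbitrary: S r G \<epsilon> rule: less_induct)
  case less
  note S = less.prems(1) and r = less.prems(2) and hol = less.prems(3) and acc = less.prems(4) and eps = less.prems(5)
  have S0: "0 \<in> S" using S by (rule vec.subspace_0)
  show ?case
  proof (cases "\<forall>g\<in>G. \<forall>p\<in>polydisc S r. g p = 0")
    case True
    have "(0, t) \<in> polydisc S r" if "norm t < r" for t using that S0 r by (simp add: polydisc_def)
    then have "\<exists>z\<in>S. norm z < \<epsilon> \<and> (\<forall>g\<in>G. g (z,t) = 0)" if "norm t < r" for t
      using True eps S0 that by (intro bexI[of _ 0]) auto
    then show ?thesis using r by blast
  next
    case False
    then obtain g p where g: "g \<in> G" "p \<in> polydisc S r" "g p \<noteq> 0" by auto
    obtain \<rho> k q e where \<rho>: "0 < \<rho>" "\<rho> < r" and q: "hol_along (lines S) (polydisc S \<rho>) q"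
      and gq: "\<And>z t. (z,t) \<in> polydisc S \<rho> \<Longrightarrow> g (z,t) = t ^ k * q (z,t)"
      and e: "e \<in> S" "norm e < \<rho>" "q (e, 0) \<noteq> 0"
      using divide_by_power[OF S hol[OF g(1)] g(2,3)] by blast
    have qc: "continuous_on (polydisc S \<rho>) q" using q by (simp add: hol_along_def)
    have zero_q: "q p = 0" if "p \<in> polydisc S \<rho>" "snd p \<noteq> 0" "g p = 0" for p
      using gq[of "fst p" "snd p"] that by simp
    \<comment> \<open>Otherwise \<open>q\<close> would be nonzero near the origin, whereas it
      vanishes at the common zeros of \<open>G\<close> off t = 0, which accumulate there.\<close>
    have "e \<noteq> 0"
    proof
      assume "e = 0"
      have in0: "(0,0) \<in> polydisc S \<rho>" using S0 \<rho> by (simp add: polydisc_def)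
      obtain d where d: "d > 0" "\<And>x. x \<in> polydisc S \<rho> \<Longrightarrow> dist x (0,0) < d \<Longrightarrow> dist (q x) (q (0,0)) < norm (q (0,0))"
        using qc[unfolded continuous_on_iff, rule_format, OF in0, of "norm (q (0,0))"] e \<open>e = 0\<close> by auto
      obtain x where x: "x \<in> polydisc S (min \<rho> (d/2))" "snd x \<noteq> 0" "\<forall>g\<in>G. g x = 0"
        using acc[of "min \<rho> (d/2)"] \<rho> d by auto
      have x\<rho>: "x \<in> polydisc S \<rho>" using x(1) by (auto simp: polydisc_def)
      have "dist x (0,0) \<le> norm (fst x) + norm (snd x)"
        by (cases x) (simp add: dist_norm norm_Pair_le flip: zero_prod_def)
      also have "\<dots> < d" using x(1) by (auto simp: polydisc_def)
      finally have "q x \<noteq> 0" using d(2)[OF x\<rho>] by auto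
      then show False using zero_q[OF x\<rho> x(2)] x(3) g(1) by auto
    qed
    then obtain j where j: "e $ j \<noteq> 0" by (auto simp: vec_eq_iff)
    \<comment> \<open>A complement in \<open>S\<close> of the line through \<open>e\<close>, so that
      projecting along \<open>e\<close> lowers the dimension.\<close>
    define S' where "S' = {z\<in>S. z $ j = 0}"
    have S': "vec.subspace S'" using S by (auto simp: S'_def vec.subspace_def)
    have S'S: "S' \<subseteq> S" by (auto simp: S'_def)
    have S'0: "0 \<in> S'" using S' by (rule vec.subspace_0)
    have dim: "vec.dim S' < vec.dim S"
      using vec.subspace_dim_equal[OF S' S S'S] e(1) j by (fastforce simp: S'_def not_less)
    have ne: "norm e > 0" using \<open>e \<noteq> 0\<close> by simp
    define M where "M = \<rho> / norm e"
    have M: "M > 1" using e ne by (simp add: M_def)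
    have "(\<lambda>x. q (0 + x *s e, 0 + x * 0)) holomorphic_on {x. (0 + x *s e, 0 + x * 0) \<in> polydisc S \<rho>}"
      using q S0 e unfolding hol_along_lines by blast
    moreover have "{x. (0 + x *s e, 0 + x * 0) \<in> polydisc S \<rho>} = ball 0 M"
      using \<rho>(1) e(1) S by (auto simp: polydisc_def M_def norm_vector_scalar_mult pos_less_divide_eq[OF ne] vec.subspace_scale)
    ultimately have "(\<lambda>x. q (x *s e, 0)) holomorphic_on ball 0 M" by simp
    \<comment> \<open>The function of \<open>x\<close> is nonzero at 1, a point of its disc because
      \<open>M > 1\<close>, so it has no zeros in a punctured neighbourhood of 0.\<close>
    then have "\<forall>\<^sub>F x in at 0. q (x *s e, 0) \<noteq> 0 \<and> x \<in> ball 0 M"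
      by (rule non_zero_neighbour_alt[where \<beta> = 1]) (use M e in auto)
    then obtain R0 where R0: "R0 > 0" "\<And>x. x \<noteq> 0 \<Longrightarrow> norm x < R0 \<Longrightarrow> q (x *s e, 0) \<noteq> 0"
      unfolding eventually_at by auto
    \<comment> \<open>Within \<open>R0\<close> the fibre over the origin has at most the zero s = 0.
      The other bounds keep \<open>s *s e\<close> within half of \<open>\<rho>\<close> and half of
      \<open>\<epsilon>\<close>, leaving the other halves to the base point.\<close>
    define R where "R = min R0 (min (M / 2) (\<epsilon> / (2 * norm e)))"
    define s1 where "s1 = R / 2"
    have R: "0 < s1" "s1 < R" "R > 0" "R \<le> R0" "R * norm e \<le> \<rho> / 2" "R * norm e \<le> \<epsilon> / 2"
    proof -
      show "R > 0" "R \<le> R0" using R0 M eps ne by (auto simp: R_def)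
      then show "0 < s1" "s1 < R" by (auto simp: s1_def)
      have "R \<le> M / 2" "R \<le> \<epsilon> / (2 * norm e)" by (auto simp: R_def)
      then show "R * norm e \<le> \<rho> / 2" "R * norm e \<le> \<epsilon> / 2"
        using ne by (auto simp: M_def field_simps)
    qed
    have dom: "(fst w + s *s e, snd w) \<in> polydisc S \<rho>" if "w \<in> polydisc S' (\<rho>/2)" "norm s < R" for w s
    proof -
      have "norm (fst w + s *s e) \<le> norm (fst w) + norm s * norm e"
        by (metis norm_triangle_ineq norm_vector_scalar_mult)
      also have "\<dots> < \<rho> / 2 + R * norm e"
        using that by (intro add_less_le_mono mult_right_mono) (auto simp: polydisc_def)
      finally show ?thesis
        using that S S'S e R \<rho> by (auto simp: polydisc_def intro!: vec.subspace_add vec.subspace_scale)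
    qed
    \<comment> \<open>Compactness of the circle of radius \<open>s1\<close> spreads the absence of
      zeros on it from the base point (0,0) to all base points in a small polydisc.\<close>
    have "\<exists>\<sigma>>0. \<sigma> \<le> \<rho> / 2 \<and> (\<forall>w\<in>polydisc S' \<sigma>. \<forall>s. norm s = s1 \<longrightarrow> q (fst w + s *s e, snd w) \<noteq> 0)"
    proof (rule ccontr)
      assume no: "\<not> ?thesis"
      have "\<exists>w s. w \<in> polydisc S' (\<rho> / 2 / Suc n) \<and> norm s = s1 \<and> q (fst w + s *s e, snd w) = 0" for n
      proof -
        have "\<rho> / 2 / Suc n > 0" "\<rho> / 2 / Suc n \<le> \<rho> / 2" using \<rho> by (auto simp: field_simps)
        then show ?thesis using no by blast
      qed
      then obtain w s where w: "\<And>n. w n \<in> polydisc S' (\<rho> / 2 / Suc n)" and s: "\<And>n. norm (s n) = s1"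
        and z: "\<And>n. q (fst (w n) + s n *s e, snd (w n)) = 0" by metis
      have lim0: "(\<lambda>n. \<rho> / 2 / Suc n) \<longlonglongrightarrow> 0" by real_asymp
      have fw: "(\<lambda>n. fst (w n)) \<longlonglongrightarrow> 0"
        by (rule Lim_null_comparison[OF _ lim0]) (use w in \<open>auto simp: polydisc_def less_imp_le\<close>)
      have sw: "(\<lambda>n. snd (w n)) \<longlonglongrightarrow> 0"
        by (rule Lim_null_comparison[OF _ lim0]) (use w in \<open>auto simp: polydisc_def less_imp_le\<close>)
      have "\<forall>n. s n \<in> sphere 0 s1" using s by simp
      then obtain s0 \<phi> where s0: "s0 \<in> sphere (0::complex) s1" and \<phi>: "strict_mono (\<phi> :: nat \<Rightarrow> nat)" "(s \<circ> \<phi>) \<longlonglongrightarrow> s0"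
        using compact_sphere[of "0::complex" s1] unfolding compact_def by blast
      have lim: "(\<lambda>n. (fst (w (\<phi> n)) + s (\<phi> n) *s e, snd (w (\<phi> n)))) \<longlonglongrightarrow> (0 + s0 *s e, 0)"
        using LIMSEQ_subseq_LIMSEQ[OF fw \<phi>(1)] LIMSEQ_subseq_LIMSEQ[OF sw \<phi>(1)] \<phi>(2)
        by (intro tendsto_intros bounded_bilinear.tendsto[OF bounded_bilinear_vector_scalar_mult])
          (auto simp: o_def)
      have "(\<lambda>n. q (fst (w (\<phi> n)) + s (\<phi> n) *s e, snd (w (\<phi> n)))) \<longlonglongrightarrow> q (0 + s0 *s e, 0)"
      proof (rule continuous_on_tendsto_compose[OF qc lim])
        show "(0 + s0 *s e, 0) \<in> polydisc S \<rho>"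
          using dom[of "(0,0)" s0] S'0 s0 R \<rho> by (auto simp: polydisc_def)
        have "w n \<in> polydisc S' (\<rho> / 2)" for n
          using w[of n] polydisc_mono[of "\<rho> / 2 / Suc n" "\<rho> / 2" S' S'] \<rho> by (auto simp: field_simps)
        then show "\<forall>\<^sub>F n in sequentially. (fst (w (\<phi> n)) + s (\<phi> n) *s e, snd (w (\<phi> n))) \<in> polydisc S \<rho>"
          using dom s R by (intro always_eventually allI) auto
      qed
      then have "q (s0 *s e, 0) = 0" using z by (simp add: LIMSEQ_const_iff)
      then show False using R0(2)[of s0] s0 R by auto
    qed
    then obtain \<sigma> where \<sigma>: "0 < \<sigma>" "\<sigma> \<le> \<rho> / 2"
      and nz: "\<And>w s. w \<in> polydisc S' \<sigma> \<Longrightarrow> norm s = s1 \<Longrightarrow> q (fst w + s *s e, snd w) \<noteq> 0" by blast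
    let ?D = "polydisc S' \<sigma>" and ?L = "lines S'"
    have famq: "hol_family ?L ?D R (\<lambda>w s. q (fst w + s *s e, snd w))"
      by (rule hol_family_translate[OF S S'S e(1) q]) (use R \<sigma> in auto)
    have famh: "hol_family ?L ?D R (\<lambda>w s. h (fst w + s *s e, snd w))" if "h \<in> combinations G" for h
      by (rule hol_family_translate[OF S S'S e(1) hol_along_combinations[OF that hol]]) (use R \<sigma> \<rho> in auto)
    define common where "common w \<longleftrightarrow> (\<exists>s\<in>ball 0 s1. q (fst w + s *s e, snd w) = 0 \<and> (\<forall>h\<in>G. h (fst w + s *s e, snd w) = 0))" for w
    \<comment> \<open>A norm enters only through its zero set. The family is infinite in general,
      which the induction admits since it speaks of arbitrary families.\<close>
    define G' where "G' = {F. hol_along ?L ?D F \<and> (\<exists>h\<in>combinations G. \<forall>w\<in>?D. F w = 0 \<longleftrightarrow>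
        (\<exists>s\<in>ball 0 s1. q (fst w + s *s e, snd w) = 0 \<and> h (fst w + s *s e, snd w) = 0))}"
    have G': "(\<forall>F\<in>G'. F w = 0) \<longleftrightarrow> common w" if w: "w \<in> ?D" for w
    proof
      assume "common w"
      then show "\<forall>F\<in>G'. F w = 0"
        using w unfolding G'_def common_def by (blast intro: combinations_vanish)
    next
      assume F0: "\<forall>F\<in>G'. F w = 0"
      show "common w"
      proof (rule ccontr)
        assume nc: "\<not> common w"
        define Z where "Z = {s\<in>ball 0 s1. q (fst w + s *s e, snd w) = 0}"
        have qh: "(\<lambda>s. q (fst w + s *s e, snd w)) holomorphic_on ball 0 R" using famq w by (simp add: hol_family_def)
        have "\<exists>xs. set xs = Z"
          using power_sums_of_zeros[OF qh qh R(1,2)] nz w unfolding Z_def by blast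
        then have "finite Z" by (metis List.finite_set)
        \<comment> \<open>The combination depends on the point \<open>w\<close>; this is why
          \<open>G'\<close> collects the norms of all combinations.\<close>
        then have "\<exists>h\<in>combinations G. \<forall>p\<in>(\<lambda>s. (fst w + s *s e, snd w)) ` Z. h p \<noteq> 0"
          by (intro combination_avoids_zeros) (use g nc in \<open>auto simp: Z_def common_def\<close>)
        then obtain h where h: "h \<in> combinations G" "\<forall>s\<in>Z. h (fst w + s *s e, snd w) \<noteq> 0" by auto
        obtain F where "hol_along ?L ?D F" "\<forall>w\<in>?D. F w = 0 \<longleftrightarrow>
            (\<exists>s\<in>ball 0 s1. q (fst w + s *s e, snd w) = 0 \<and> h (fst w + s *s e, snd w) = 0)"
          using eliminate_variable[OF open_along_lines[OF S'] connected_polydisc[OF S'] R(1,2) famq famh[OF h(1)] nz] by blast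
        moreover from this have "F \<in> G'" using h(1) unfolding G'_def by blast
        ultimately show False using F0 w h(2) unfolding Z_def by blast
      qed
    qed
    have acc': "\<exists>p\<in>polydisc S' \<eta>. snd p \<noteq> 0 \<and> (\<forall>F\<in>G'. F p = 0)" if \<eta>: "\<eta> > 0" for \<eta>
    proof -
      \<comment> \<open>\<open>C\<close> bounds the norm of the projection along \<open>e\<close>
        onto \<open>S'\<close>. In \<open>\<theta>\<close>, the first bound puts the projected point
        into the polydiscs of radii \<open>\<eta>\<close> and \<open>\<sigma>\<close>, the second
        keeps the fibre coordinate below \<open>s1\<close>.\<close>
      define C where "C = 1 + norm e / norm (e $ j)"
      have C: "C \<ge> 1" by (simp add: C_def)
      define \<theta> where "\<theta> = min (min \<eta> \<sigma> / C) (s1 * norm (e $ j))"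
      have "\<theta> > 0" using \<eta> \<sigma> C R j by (auto simp: \<theta>_def)
      then obtain x where x: "x \<in> polydisc S \<theta>" "snd x \<noteq> 0" "\<forall>g\<in>G. g x = 0" using acc by blast
      define s where "s = fst x $ j / e $ j"
      define z where "z = fst x - s *s e"
      have xz: "x = (z + s *s e, snd x)" by (simp add: z_def)
      have xn: "norm (fst x) < \<theta>" "norm (snd x) < \<theta>" "fst x \<in> S" using x(1) by (auto simp: polydisc_def)
      have xj: "norm (fst x $ j) \<le> norm (fst x)" by (rule Finite_Cartesian_Product.norm_nth_le)
      have "\<theta> * C \<le> min \<eta> \<sigma>"
      proof -
        have "\<theta> \<le> min \<eta> \<sigma> / C" by (simp add: \<theta>_def)
        then show ?thesis using C by (simp add: pos_le_divide_eq)
      qed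
      moreover have "\<theta> \<le> \<theta> * C" using C \<open>\<theta> > 0\<close> by (simp add: mult_le_cancel_left1)
      moreover have "norm z \<le> norm (fst x) * C"
      proof -
        have "norm z \<le> norm (fst x) + norm s * norm e"
          unfolding z_def by (metis norm_triangle_ineq4 norm_vector_scalar_mult)
        also have "norm s * norm e \<le> norm (fst x) * (norm e / norm (e $ j))"
          using xj j by (simp add: s_def norm_divide field_simps mult_left_mono)
        finally show ?thesis by (simp add: C_def algebra_simps)
      qed
      moreover have "norm (fst x) * C < \<theta> * C" using xn C by simp
      ultimately have zn: "norm z < \<eta>" "norm z < \<sigma>" "norm (snd x) < \<eta>" "norm (snd x) < \<sigma>" using xn by auto
      have sn: "norm s < s1"
      proof -
        have "norm (fst x $ j) < s1 * norm (e $ j)" using xj xn by (auto simp: \<theta>_def)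
        then show ?thesis using j by (simp add: s_def norm_divide field_simps)
      qed
      have zS: "z \<in> S'"
        using S xn e j by (auto simp: S'_def z_def s_def vec.subspace_diff vec.subspace_scale)
      have inD: "(z, snd x) \<in> ?D" using zS zn by (simp add: polydisc_def)
      have "x \<in> polydisc S \<rho>"
        using dom[of "(z, snd x)" s] xz inD polydisc_mono[OF \<sigma>(2), of S' S'] sn R by auto
      then have "q x = 0" using zero_q x g by blast
      then have "common (z, snd x)"
        using xz sn x(3) unfolding common_def by (intro bexI[of _ s]) auto
      then have "\<forall>F\<in>G'. F (z, snd x) = 0" using G'[OF inD] by blast
      then show ?thesis using zS zn x(2) by (intro bexI[of _ "(z, snd x)"]) (auto simp: polydisc_def)
    qed
    have "\<exists>\<delta>>0. \<forall>t. t \<noteq> 0 \<and> norm t < \<delta> \<longrightarrow> (\<exists>z\<in>S'. norm z < min \<sigma> (\<epsilon>/2) \<and> (\<forall>F\<in>G'. F (z,t) = 0))"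
      by (rule less.hyps[OF dim S' \<sigma>(1) _ acc']) (use eps \<sigma> in \<open>auto simp: G'_def\<close>)
    then obtain \<delta> where \<delta>: "\<delta> > 0"
      "\<And>t. t \<noteq> 0 \<Longrightarrow> norm t < \<delta> \<Longrightarrow> \<exists>z\<in>S'. norm z < min \<sigma> (\<epsilon>/2) \<and> (\<forall>F\<in>G'. F (z,t) = 0)" by blast
    show ?thesis
    proof (intro exI[of _ "min \<delta> \<sigma>"] conjI allI impI)
      fix t :: complex assume t: "t \<noteq> 0 \<and> norm t < min \<delta> \<sigma>"
      then obtain z where z: "z \<in> S'" "norm z < \<sigma>" "norm z < \<epsilon> / 2" "\<forall>F\<in>G'. F (z,t) = 0" using \<delta>(2)[of t] by auto
      then have "common (z,t)" using G'[of "(z,t)"] t by (simp add: polydisc_def)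
      then obtain s where s: "norm s < s1" "\<forall>h\<in>G. h (z + s *s e, t) = 0" by (auto simp: common_def)
      have "norm (z + s *s e) \<le> norm z + norm s * norm e"
        by (metis norm_triangle_ineq norm_vector_scalar_mult)
      also have "\<dots> < \<epsilon> / 2 + R * norm e"
        using z s R by (intro add_less_le_mono mult_right_mono) auto
      finally have "norm (z + s *s e) < \<epsilon>" using R by simp
      then show "\<exists>z\<in>S. norm z < \<epsilon> \<and> (\<forall>g\<in>G. g (z,t) = 0)"
        using s z S S'S e by (intro bexI[of _ "z + s *s e"]) (auto intro!: vec.subspace_add vec.subspace_scale)
    qed (use \<delta> \<sigma> in auto)
  qed
qed

section \<open>Complex tangent cones\<close>

text \<open>Take t = 1 / c_i and z = c_i u_i. Then |t| = |u_i| / |c_i u_i|, where the denominators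
  tend to the nonzero number |v|, so t tends to 0.\<close>

lemma LDstar_approx:
  assumes "v \<in> LDstar A" "v \<noteq> 0" "\<eta> > 0"
  shows "\<exists>t z. t \<noteq> 0 \<and> norm t < \<eta> \<and> norm (z - v) < \<eta> \<and> t *s z \<in> A - {0} \<and> norm (t *s z) < \<eta>"
proof -
  obtain c u where u: "\<And>i::nat. u i \<in> A - {0}" "u \<longlonglongrightarrow> 0" and cu: "(\<lambda>i. c i *s u i) \<longlonglongrightarrow> v"
    using assms(1) by (auto simp: LDstar_def)
  have ne: "\<forall>\<^sub>F i in sequentially. c i *s u i \<noteq> 0"
    using tendsto_imp_eventually_ne[OF cu assms(2)] .
  have "(\<lambda>i. norm (u i) / norm (c i *s u i)) \<longlonglongrightarrow> 0 / norm v"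
    using assms(2) by (intro tendsto_divide tendsto_norm tendsto_norm_zero u(2) cu) auto
  then have "\<forall>\<^sub>F i in sequentially. norm (u i) / norm (c i *s u i) < \<eta>"
    using assms(3) by (intro order_tendstoD) auto
  moreover have "\<forall>\<^sub>F i in sequentially. norm (c i *s u i - v) < \<eta>"
    using tendstoD[OF cu assms(3)] by (simp add: dist_norm)
  moreover have "\<forall>\<^sub>F i in sequentially. norm (u i) < \<eta>"
    using tendstoD[OF u(2) assms(3)] by (simp add: dist_norm)
  ultimately have "\<forall>\<^sub>F i in sequentially. c i *s u i \<noteq> 0 \<and> norm (u i) / norm (c i *s u i) < \<eta>
      \<and> norm (c i *s u i - v) < \<eta> \<and> norm (u i) < \<eta>"
    using ne by (simp add: eventually_conj_iff)
  then obtain i where i: "c i *s u i \<noteq> 0" "norm (u i) / norm (c i *s u i) < \<eta>"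
      "norm (c i *s u i - v) < \<eta>" "norm (u i) < \<eta>"
    unfolding eventually_sequentially by blast
  have c: "c i \<noteq> 0" using i(1) by auto
  have eq: "(1 / c i) *s (c i *s u i) = u i" using c by (simp add: vec_eq_iff)
  have "norm (1 / c i) < \<eta>" using i(2) c u(1)[of i] by (simp add: norm_vector_scalar_mult norm_divide)
  then show ?thesis
    using c i eq u(1)[of i] by (intro exI[of _ "1 / c i"] exI[of _ "c i *s u i"]) auto
qed

text \<open>The derivatives of \<open>f\<close> are real ones commuting with complex scalars. Along
  the image of a complex line the chain rule then gives multiplication by a complex number, that is,
  a complex derivative.\<close>

lemma hol_along_cone_map:
  fixes f :: "complex^'n \<Rightarrow> complex"
  assumes f: "holomorphic_n f U" and dom: "\<And>p. p \<in> polydisc UNIV r \<Longrightarrow> snd p *s (v + fst p) \<in> U"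
  shows "hol_along (lines UNIV) (polydisc UNIV r) (\<lambda>p. f (snd p *s (v + fst p)))"
  unfolding hol_along_lines
proof (intro conjI ballI allI)
  have "continuous_on U f"
    using f unfolding holomorphic_n_def
    by (metis continuous_at_imp_continuous_on has_derivative_continuous)
  then show "continuous_on (polydisc UNIV r) (\<lambda>p. f (snd p *s (v + fst p)))"
    by (rule continuous_on_compose2) (use dom in \<open>auto intro!: continuous_intros\<close>)
  fix a b :: "complex^'n" and s t :: complex
  let ?\<gamma> = "\<lambda>x. (s + x * t) *s (v + (a + x *s b))"
  show "(\<lambda>x. f (snd (a + x *s b, s + x * t) *s (v + fst (a + x *s b, s + x * t))))
      holomorphic_on {x. (a + x *s b, s + x * t) \<in> polydisc UNIV r}"
    unfolding holomorphic_on_def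
  proof
    fix x assume "x \<in> {x. (a + x *s b, s + x * t) \<in> polydisc UNIV r}"
    then have "?\<gamma> x \<in> U" using dom by fastforce
    then obtain f' where f': "(f has_derivative f') (at (?\<gamma> x))" "\<And>c v. f' (c *s v) = c * f' v"
      using f unfolding holomorphic_n_def by blast
    have lin: "((\<lambda>x. v + (a + x *s b)) has_derivative (\<lambda>h. h *s b)) (at x)"
      using bounded_linear_imp_has_derivative[OF bounded_bilinear.bounded_linear_left[OF bounded_bilinear_vector_scalar_mult]]
      by (auto intro!: derivative_eq_intros)
    have "((\<lambda>x. s + x * t) has_derivative (\<lambda>h. h * t)) (at x)"
      by (auto intro!: derivative_eq_intros)
    from bounded_bilinear.FDERIV[OF bounded_bilinear_vector_scalar_mult this lin]
    have "(?\<gamma> has_derivative (\<lambda>h. (s + x * t) *s (h *s b) + (h * t) *s (v + (a + x *s b)))) (at x)" .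
    from diff_chain_at[OF this f'(1)]
    have "((\<lambda>x. f (?\<gamma> x)) has_derivative
        (\<lambda>h. f' ((s + x * t) *s (h *s b) + (h * t) *s (v + (a + x *s b))))) (at x)"
      by (simp add: o_def)
    moreover have "f' ((s + x * t) *s (h *s b) + (h * t) *s (v + (a + x *s b)))
        = f' ((s + x * t) *s b + t *s (v + (a + x *s b))) * h" for h
    proof -
      have "(s + x * t) *s (h *s b) + (h * t) *s (v + (a + x *s b))
          = h *s ((s + x * t) *s b + t *s (v + (a + x *s b)))"
        by (simp add: vec_eq_iff algebra_simps)
      then show ?thesis by (simp only: f'(2) mult.commute)
    qed
    ultimately have "((\<lambda>x. f (?\<gamma> x)) has_field_derivative
        f' ((s + x * t) *s b + t *s (v + (a + x *s b)))) (at x)"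
      by (simp add: has_field_derivative_def)
    then show "(\<lambda>x. f (snd (a + x *s b, s + x * t) *s (v + fst (a + x *s b, s + x * t))))
      field_differentiable at x within {x. (a + x *s b, s + x * t) \<in> polydisc UNIV r}"
      by (auto simp: field_differentiable_def intro: DERIV_subset)
  qed
qed

text \<open>Passes from a sequence of scales t to all small complex t; the sequence itself supplies
  the accumulation at the origin demanded by \<open>fibres_near_origin\<close>.\<close>

lemma cone_direction_realised:
  fixes V :: "(complex^'n) set"
  assumes "analytic_variety_germ V" "v \<in> LDstar V" "v \<noteq> 0" "\<epsilon> > 0"
  shows "\<exists>\<delta>>0. \<forall>t. t \<noteq> 0 \<and> norm t < \<delta> \<longrightarrow> (\<exists>z. norm (z - v) < \<epsilon> \<and> t *s z \<in> V)"
proof -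
  obtain U F where U: "open U" "0 \<in> U" and F: "\<And>f. f \<in> F \<Longrightarrow> holomorphic_n f U"
    and V: "V \<inter> U = {x\<in>U. \<forall>f\<in>F. f x = 0}"
    using assms(1) unfolding analytic_variety_germ_def by blast
  obtain d where d: "d > 0" "ball 0 d \<subseteq> U" using U open_contains_ball by blast
  \<comment> \<open>For |t| < r and |y| < r this gives |t (v + y)| < r (|v| + 1) \<le> d, so the
    cone map lands in \<open>U\<close>.\<close>
  define r where "r = min 1 (d / (norm v + 1))"
  have r: "0 < r" "r \<le> 1" "r * (norm v + 1) \<le> d"
  proof -
    have v1: "norm v + 1 > 0" by (simp add: add_nonneg_pos)
    then show "0 < r" "r \<le> 1" using d by (auto simp: r_def)
    have "r \<le> d / (norm v + 1)" by (simp add: r_def)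
    then show "r * (norm v + 1) \<le> d" using v1 by (simp add: pos_le_divide_eq)
  qed
  have dom: "snd p *s (v + fst p) \<in> U" if "p \<in> polydisc UNIV r" for p
  proof -
    have p: "norm (fst p) < r" "norm (snd p) < r" using that by (auto simp: polydisc_def)
    have "norm (v + fst p) \<le> norm v + 1" using p r norm_triangle_ineq[of v "fst p"] by linarith
    then have "norm (snd p *s (v + fst p)) \<le> norm (snd p) * (norm v + 1)"
      unfolding norm_vector_scalar_mult by (intro mult_left_mono) auto
    also have "\<dots> < r * (norm v + 1)"
      using p by (intro mult_strict_right_mono) (auto simp: add_nonneg_pos)
    finally show ?thesis using d r by auto
  qed
  define G where "G = (\<lambda>f p. f (snd p *s (v + fst p))) ` F"
  have "\<exists>\<delta>>0. \<forall>t. t \<noteq> 0 \<and> norm t < \<delta> \<longrightarrow> (\<exists>z\<in>UNIV. norm z < min \<epsilon> r \<and> (\<forall>g\<in>G. g (z, t) = 0))"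
  proof (rule fibres_near_origin[OF vec.subspace_UNIV r(1)])
    show "hol_along (lines UNIV) (polydisc UNIV r) g" if "g \<in> G" for g
      using that hol_along_cone_map[OF F dom] by (auto simp: G_def)
    show "\<exists>p\<in>polydisc UNIV \<eta>. snd p \<noteq> 0 \<and> (\<forall>g\<in>G. g p = 0)" if \<eta>: "\<eta> > 0" for \<eta>
    proof -
      obtain t z where tz: "t \<noteq> 0" "norm t < min \<eta> d" "norm (z - v) < min \<eta> d" "t *s z \<in> V - {0}" "norm (t *s z) < min \<eta> d"
        using LDstar_approx[OF assms(2,3), of "min \<eta> d"] \<eta> d by auto
      then have "t *s z \<in> V \<inter> U" using d by auto
      then have "f (t *s z) = 0" if "f \<in> F" for f using V that by blast
      then show ?thesis using tz
        by (intro bexI[of _ "(z - v, t)"]) (auto simp: G_def polydisc_def)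
    qed
  qed (use assms r in auto)
  then obtain \<delta> where \<delta>: "\<delta> > 0"
    "\<And>t. t \<noteq> 0 \<Longrightarrow> norm t < \<delta> \<Longrightarrow> \<exists>z. norm z < min \<epsilon> r \<and> (\<forall>g\<in>G. g (z, t) = 0)" by blast
  have "\<exists>z. norm (z - v) < \<epsilon> \<and> t *s z \<in> V" if t: "t \<noteq> 0" "norm t < min \<delta> r" for t
  proof -
    obtain z where z: "norm z < min \<epsilon> r" "\<forall>g\<in>G. g (z, t) = 0" using \<delta>(2)[of t] t by auto
    have "t *s (v + z) \<in> U" using dom[of "(z,t)"] z t by (simp add: polydisc_def)
    moreover have "\<forall>f\<in>F. f (t *s (v + z)) = 0" using z by (simp add: G_def)
    ultimately have "t *s (v + z) \<in> V" using V by blast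
    then show ?thesis using z by (intro exI[of _ "v + z"]) auto
  qed
  then show ?thesis using \<delta>(1) r(1) by (intro exI[of _ "min \<delta> r"]) auto
qed

text \<open>For \<open>V = A\<close> one may take \<open>v = a\<close>, so the condition then says
  that \<open>A\<close> accumulates at 0.\<close>

definition tangential :: "(complex^'n) set \<Rightarrow> (complex^'n) set \<Rightarrow> bool" where
  "tangential A V \<longleftrightarrow> (\<forall>\<epsilon>>0. \<exists>a\<in>A - {0}. \<exists>v\<in>V. norm a < \<epsilon> \<and> norm (a - v) \<le> \<epsilon> * norm a)"

text \<open>\<open>A\<close> dictates the scale t through a point t y with y near u, and
  \<open>V\<close> follows with a point t z at the same scale; their relative distance is |y - z| /
  |y|.\<close>

lemma tangential_if_cones_meet:
  fixes V :: "(complex^'n) set"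
  assumes "analytic_variety_germ V" "u \<in> LDstar A" "u \<in> LDstar V" "u \<noteq> 0"
  shows "tangential A V"
  unfolding tangential_def
proof (intro allI impI)
  fix \<epsilon> :: real assume eps: "\<epsilon> > 0"
  \<comment> \<open>Both |y - u| and |z - u| are at most \<open>\<eta>\<close>, and |y| is at least
    |u| / 2; hence the factor 4.\<close>
  define \<eta> where "\<eta> = \<epsilon> * norm u / 4"
  have \<eta>: "\<eta> > 0" using eps assms(4) by (simp add: \<eta>_def)
  obtain \<delta> where \<delta>: "\<delta> > 0" "\<And>t. t \<noteq> 0 \<Longrightarrow> norm t < \<delta> \<Longrightarrow> \<exists>z. norm (z - u) < \<eta> \<and> t *s z \<in> V"
    using cone_direction_realised[OF assms(1,3,4) \<eta>] by blast
  define \<theta> where "\<theta> = min (min \<epsilon> \<delta>) (min \<eta> (norm u / 2))"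
  have "\<theta> > 0" using eps \<eta> \<delta> assms(4) by (simp add: \<theta>_def)
  then obtain t y where t: "t \<noteq> 0" "norm t < \<theta>" "norm (y - u) < \<theta>" "t *s y \<in> A - {0}" "norm (t *s y) < \<theta>"
    using LDstar_approx[OF assms(2,4)] by blast
  then obtain z where z: "norm (z - u) < \<eta>" "t *s z \<in> V" using \<delta>(2)[of t] by (auto simp: \<theta>_def)
  have "norm (y - z) \<le> norm (y - u) + norm (z - u)" 
    using norm_triangle_ineq4[of "y - u" "z - u"] by simp
  also have "\<dots> \<le> 2 * \<eta>" using z t by (auto simp: \<theta>_def)
  also have "\<dots> = \<epsilon> * (norm u / 2)" by (simp add: \<eta>_def)
  also have "\<dots> \<le> \<epsilon> * norm y"
  proof -
    have "norm u \<le> norm y + norm (y - u)" by (metis norm_minus_commute norm_triangle_sub)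
    then have "norm u / 2 \<le> norm y" using t by (auto simp: \<theta>_def)
    then show ?thesis using eps by simp
  qed
  finally have "norm t * norm (y - z) \<le> norm t * (\<epsilon> * norm y)" by (rule mult_left_mono) simp
  moreover have "norm (t *s y - t *s z) = norm t * norm (y - z)"
    by (metis norm_vector_scalar_mult vector_ssub_ldistrib)
  ultimately have "norm (t *s y - t *s z) \<le> \<epsilon> * norm (t *s y)"
    by (simp add: norm_vector_scalar_mult algebra_simps)
  then show "\<exists>a\<in>A - {0}. \<exists>v\<in>V. norm a < \<epsilon> \<and> norm (a - v) \<le> \<epsilon> * norm a"
    using t z by (intro bexI[of _ "t *s y"] bexI[of _ "t *s z"]) (auto simp: \<theta>_def)
qed

lemma cones_meet_if_tangential:
  fixes V :: "(complex^'n) set"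
  assumes "tangential A V"
  shows "\<exists>u. u \<noteq> 0 \<and> u \<in> LDstar A \<inter> LDstar V"
proof -
  \<comment> \<open>The offset 2 makes the bound at most 1/2 already at n = 0; this keeps the points
    \<open>v n\<close> away from 0, as the cone requires.\<close>
  have "\<exists>a v. a \<in> A - {0} \<and> v \<in> V \<and> norm a < 1 / (real n + 2) \<and> norm (a - v) \<le> 1 / (real n + 2) * norm a" for n :: nat
  proof -
    have "1 / (real n + 2) > 0" by simp
    then show ?thesis using assms unfolding tangential_def by blast
  qed
  then obtain a v where a: "\<And>n. a n \<in> A - {0}" "\<And>n. norm (a n) < 1 / (real n + 2)"
    and v: "\<And>n. v n \<in> V" "\<And>n. norm (a n - v n) \<le> 1 / (real n + 2) * norm (a n)"
    by metis
  have lim: "(\<lambda>n. 1 / (real n + 2)) \<longlonglongrightarrow> 0" by real_asymp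
  have half: "1 / (real n + 2) \<le> 1 / 2" for n by (simp add: field_simps)
  \<comment> \<open>The same multipliers serve \<open>a\<close> and \<open>v\<close>, so the scaled
    points differ by |a - v| / |a| and have the same limit.\<close>
  define c where "c n = complex_of_real (1 / norm (a n))" for n
  have v0: "v n \<noteq> 0" for n
  proof
    assume "v n = 0"
    then have "norm (a n) \<le> 1 / 2 * norm (a n)"
      using order_trans[OF v(2)[of n] mult_right_mono[OF half norm_ge_zero]] by simp
    then show False using a(1)[of n] by simp
  qed
  have a_lim: "a \<longlonglongrightarrow> 0"
    by (rule Lim_null_comparison[OF _ lim]) (use a in \<open>auto simp: less_imp_le\<close>)
  have "(\<lambda>n. a n - v n) \<longlonglongrightarrow> 0"
  proof (rule Lim_null_comparison[OF always_eventually[OF allI]])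
    show "norm (a n - v n) \<le> 1 / (real n + 2) * norm (a n)" for n by (rule v)
    show "(\<lambda>n. 1 / (real n + 2) * norm (a n)) \<longlonglongrightarrow> 0"
      using tendsto_mult[OF lim tendsto_norm[OF a_lim]] by simp
  qed
  from tendsto_diff[OF a_lim this] have v_lim: "v \<longlonglongrightarrow> 0" by simp
  have "\<And>n. c n *s a n \<in> sphere 0 1" using a by (auto simp: c_def norm_vector_scalar_mult norm_divide)
  then obtain u \<phi> where u: "u \<in> sphere (0::complex^'n) 1" and \<phi>: "strict_mono (\<phi> :: nat \<Rightarrow> nat)"
    and cu: "((\<lambda>n. c n *s a n) \<circ> \<phi>) \<longlonglongrightarrow> u"
    using compact_sphere[of "0::complex^'n" 1, unfolded compact_def, rule_format, of "\<lambda>n. c n *s a n"] by blast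
  have "(\<lambda>n. c n *s a n - c n *s v n) \<longlonglongrightarrow> 0"
  proof (rule Lim_null_comparison[OF always_eventually[OF allI] lim])
    fix n
    have "norm (c n *s a n - c n *s v n) = norm (a n - v n) / norm (a n)"
      by (simp add: c_def norm_vector_scalar_mult norm_divide flip: vector_ssub_ldistrib)
    also have "\<dots> \<le> 1 / (real n + 2)"
      using v(2)[of n] a(1)[of n] by (simp add: pos_divide_le_eq)
    finally show "norm (c n *s a n - c n *s v n) \<le> 1 / (real n + 2)" .
  qed
  from tendsto_diff[OF cu LIMSEQ_subseq_LIMSEQ[OF this \<phi>]]
  have cv: "(\<lambda>n. c (\<phi> n) *s v (\<phi> n)) \<longlonglongrightarrow> u" by (simp add: o_def)
  have "u \<in> LDstar A"
    unfolding LDstar_def using a cu LIMSEQ_subseq_LIMSEQ[OF a_lim \<phi>]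
    by (intro CollectI exI[of _ "c \<circ> \<phi>"] exI[of _ "a \<circ> \<phi>"]) (auto simp: o_def)
  moreover have "u \<in> LDstar V"
    unfolding LDstar_def using v v0 cv LIMSEQ_subseq_LIMSEQ[OF v_lim \<phi>]
    by (intro CollectI exI[of _ "c \<circ> \<phi>"] exI[of _ "v \<circ> \<phi>"]) (auto simp: o_def)
  moreover have "u \<noteq> 0" using u by auto
  ultimately show ?thesis by blast
qed

text \<open>LDstar A is empty, rather than {0}, when 0 is not an accumulation point of A.\<close>

lemma zero_in_LDstar_iff: "0 \<in> LDstar A \<longleftrightarrow> tangential A A"
proof
  assume "0 \<in> LDstar A"
  then obtain u where u: "\<And>i::nat. u i \<in> A - {0}" "u \<longlonglongrightarrow> 0" by (auto simp: LDstar_def)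
  show "tangential A A"
    unfolding tangential_def
  proof (intro allI impI)
    fix \<epsilon> :: real assume "\<epsilon> > 0"
    then obtain i where "norm (u i) < \<epsilon>" using u(2) by (metis LIMSEQ_iff diff_zero order_refl)
    then show "\<exists>a\<in>A - {0}. \<exists>v\<in>A. norm a < \<epsilon> \<and> norm (a - v) \<le> \<epsilon> * norm a"
      using u(1)[of i] \<open>\<epsilon> > 0\<close> by (intro bexI[of _ "u i"] bexI[of _ "u i"]) auto
  qed
next
  assume "tangential A A"
  then have "0 islimpt A" unfolding islimpt_approachable tangential_def by (auto simp: dist_norm)
  then obtain u where "\<forall>i::nat. u i \<in> A - {0}" "u \<longlonglongrightarrow> 0" unfolding islimpt_sequential by blast
  then show "0 \<in> LDstar A" unfolding LDstar_def by (auto intro!: exI[of _ "\<lambda>_. 0"] exI[of _ u])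
qed

text \<open>Equality with {0} asserts more than the absence of a nonzero common direction: 0 has to
  lie in both cones, which the first two conjuncts record.\<close>

lemma cones_transversal_iff:
  fixes V :: "(complex^'n) set"
  assumes "analytic_variety_germ V"
  shows "LDstar A \<inter> LDstar V = {0} \<longleftrightarrow> tangential A A \<and> tangential V V \<and> \<not> tangential A V"
  using tangential_if_cones_meet[OF assms] cones_meet_if_tangential[of A V] zero_in_LDstar_iff[of A] zero_in_LDstar_iff[of V]
  by blast

section \<open>Dependence on germs and bi-Lipschitz invariance\<close>

lemma tangential_local:
  assumes "tangential A V" "r > 0" "V \<inter> ball 0 r = V' \<inter> ball 0 r"
  shows "tangential A V'"
  unfolding tangential_def
proof (intro allI impI)
  fix \<epsilon> :: real assume "\<epsilon> > 0"
  \<comment> \<open>A relative distance of at most 1 gives |v| \<le> 2 |a| < r, so \<open>v\<close>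
    lies in the ball where \<open>V\<close> and \<open>V'\<close> agree.\<close>
  define \<eta> where "\<eta> = min \<epsilon> (min 1 (r / 2))"
  have "\<eta> > 0" using \<open>\<epsilon> > 0\<close> assms(2) by (simp add: \<eta>_def)
  then obtain a v where a: "a \<in> A - {0}" "norm a < \<eta>" and v: "v \<in> V" "norm (a - v) \<le> \<eta> * norm a"
    using assms(1) unfolding tangential_def by blast
  have "norm v \<le> norm a + norm (a - v)" by (metis norm_minus_commute norm_triangle_sub)
  moreover have "norm (a - v) \<le> 1 * norm a" "norm (a - v) \<le> \<epsilon> * norm a"
    by (rule order_trans[OF v(2)], intro mult_right_mono; simp add: \<eta>_def)+
  moreover have "norm a < r / 2" using a(2) by (simp add: \<eta>_def)
  ultimately have "norm v < r" "norm (a - v) \<le> \<epsilon> * norm a" by simp_all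
  then have "v \<in> V \<inter> ball 0 r" using v(1) by simp
  then have "v \<in> V'" unfolding assms(3) by simp
  then show "\<exists>a\<in>A - {0}. \<exists>v\<in>V'. norm a < \<epsilon> \<and> norm (a - v) \<le> \<epsilon> * norm a"
    using a \<open>v \<in> V'\<close> \<open>norm (a - v) \<le> \<epsilon> * norm a\<close> by (intro bexI[of _ a] bexI[of _ v]) (auto simp: \<eta>_def)
qed

lemma tangential_self_local:
  assumes "tangential V V" "r > 0" "V \<inter> ball 0 r = V' \<inter> ball 0 r"
  shows "tangential V' V'"
  unfolding tangential_def
proof (intro allI impI)
  fix \<epsilon> :: real assume "\<epsilon> > 0"
  then obtain a where a: "a \<in> V - {0}" "norm a < min \<epsilon> r"
    using assms(1,2) unfolding tangential_def by (metis min_less_iff_conj)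
  then have "a \<in> V \<inter> ball 0 r" by simp
  then have "a \<in> V'" unfolding assms(3) by simp
  then show "\<exists>a\<in>V' - {0}. \<exists>v\<in>V'. norm a < \<epsilon> \<and> norm (a - v) \<le> \<epsilon> * norm a"
    using a \<open>\<epsilon> > 0\<close> by (intro bexI[of _ a] bexI[of _ a]) auto
qed

text \<open>Since \<open>h\<close> fixes 0, the Lipschitz bounds apply to norms as well, and the
  ratio |a - v| / |a| changes at most by the factor K2 / K1 in either direction.\<close>

lemma tangential_bilipschitz:
  assumes "bilipschitz_germ_on h U"
  shows "tangential A V \<longleftrightarrow> tangential (h ` (A \<inter> U)) (h ` (V \<inter> U))"
proof -
  obtain K1 K2 where U: "open U" "0 \<in> U" "h 0 = 0" and K: "0 < K1" "K1 \<le> K2"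
    and lo: "\<And>x y. x \<in> U \<Longrightarrow> y \<in> U \<Longrightarrow> K1 * dist x y \<le> dist (h x) (h y)"
    and up: "\<And>x y. x \<in> U \<Longrightarrow> y \<in> U \<Longrightarrow> dist (h x) (h y) \<le> K2 * dist x y"
    using assms unfolding bilipschitz_germ_on_def by blast
  have lo0: "K1 * norm x \<le> norm (h x)" and up0: "norm (h x) \<le> K2 * norm x" if "x \<in> U" for x
    using lo[OF that U(2)] up[OF that U(2)] U(3) by auto
  obtain d where d: "d > 0" "ball 0 d \<subseteq> U" using U open_contains_ball by blast
  have K2: "K2 > 0" using K by simp
  show ?thesis
  proof
    assume tan: "tangential A V"
    show "tangential (h ` (A \<inter> U)) (h ` (V \<inter> U))"
      unfolding tangential_def
    proof (intro allI impI)
      fix \<epsilon> :: real assume eps: "\<epsilon> > 0"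
      \<comment> \<open>The bounds 1 and \<open>d / 2\<close> force \<open>a\<close> and
        \<open>v\<close> into \<open>U\<close>, \<open>\<epsilon> / K2\<close> controls |h a|, and
        \<open>\<epsilon> * K1 / K2\<close> compensates the distortion of the ratio.\<close>
      define \<eta> where "\<eta> = min (min 1 (d / 2)) (min (\<epsilon> / K2) (\<epsilon> * K1 / K2))"
      have "\<eta> > 0" using eps d K K2 by (simp add: \<eta>_def)
      then obtain a v where a: "a \<in> A - {0}" "norm a < \<eta>" and v: "v \<in> V" "norm (a - v) \<le> \<eta> * norm a"
        using tan unfolding tangential_def by blast
      have "norm v \<le> norm a + norm (a - v)" by (metis norm_minus_commute norm_triangle_sub)
      moreover have "norm (a - v) \<le> 1 * norm a"
        by (rule order_trans[OF v(2)], intro mult_right_mono) (auto simp: \<eta>_def)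
      moreover have "norm a < d / 2" using a(2) by (simp add: \<eta>_def)
      ultimately have "norm a < d" "norm v < d" using d(1) by simp_all
      then have aU: "a \<in> U" "v \<in> U" using d by auto
      have ha: "norm (h a) < \<epsilon>"
      proof -
        have "norm (h a) \<le> K2 * norm a" by (rule up0[OF aU(1)])
        also have "\<dots> < K2 * \<eta>" using a K2 by simp
        also have "\<dots> \<le> K2 * (\<epsilon> / K2)" using K2 by (intro mult_left_mono) (auto simp: \<eta>_def)
        finally show ?thesis using K2 by simp
      qed
      have "norm (h a - h v) \<le> K2 * norm (a - v)" using up[OF aU] by (simp add: dist_norm)
      also have "\<dots> \<le> K2 * ((\<epsilon> * K1 / K2) * norm a)"
        using K2 by (intro mult_left_mono order_trans[OF v(2)] mult_right_mono) (auto simp: \<eta>_def)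
      also have "\<dots> = \<epsilon> * (K1 * norm a)" using K2 by simp
      also have "\<dots> \<le> \<epsilon> * norm (h a)" using lo0[OF aU(1)] eps by (intro mult_left_mono) auto
      finally have hav: "norm (h a - h v) \<le> \<epsilon> * norm (h a)" .
      have "h a \<noteq> 0" using lo0[OF aU(1)] K a by (auto simp: mult_le_0_iff)
      then show "\<exists>a\<in>h ` (A \<inter> U) - {0}. \<exists>v\<in>h ` (V \<inter> U). norm a < \<epsilon> \<and> norm (a - v) \<le> \<epsilon> * norm a"
        using a v aU ha hav by (intro bexI[of _ "h a"] bexI[of _ "h v"]) auto
    qed
  next
    assume tan: "tangential (h ` (A \<inter> U)) (h ` (V \<inter> U))"
    show "tangential A V"
      unfolding tangential_def
    proof (intro allI impI)
      fix \<epsilon> :: real assume eps: "\<epsilon> > 0"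
      define \<eta> where "\<eta> = min (\<epsilon> * K1) (\<epsilon> * K1 / K2)"
      have "\<eta> > 0" using eps K K2 by (simp add: \<eta>_def)
      then obtain b w where "b \<in> h ` (A \<inter> U) - {0}" "w \<in> h ` (V \<inter> U)" "norm b < \<eta>" "norm (b - w) \<le> \<eta> * norm b"
        using tan unfolding tangential_def by blast
      then obtain a v where a: "a \<in> A" "a \<in> U" "h a \<noteq> 0" "norm (h a) < \<eta>" and v: "v \<in> V" "v \<in> U"
        and av: "norm (h a - h v) \<le> \<eta> * norm (h a)" by auto
      have "K1 * norm a < K1 * \<epsilon>" using lo0[OF a(2)] a(4) by (simp add: \<eta>_def mult.commute)
      then have an: "norm a < \<epsilon>" using K by simp
      have "K1 * norm (a - v) \<le> norm (h a - h v)" using lo[OF a(2) v(2)] by (simp add: dist_norm)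
      also have "\<dots> \<le> \<eta> * norm (h a)" by (rule av)
      also have "\<dots> \<le> (\<epsilon> * K1 / K2) * (K2 * norm a)"
      proof (rule mult_mono[OF _ up0[OF a(2)]])
        show "\<eta> \<le> \<epsilon> * K1 / K2" by (simp add: \<eta>_def)
        show "0 \<le> \<epsilon> * K1 / K2" using eps K K2 by simp
      qed simp
      also have "\<dots> = K1 * (\<epsilon> * norm a)" using K2 by simp
      finally have "norm (a - v) \<le> \<epsilon> * norm a" using K by simp
      moreover have "a \<noteq> 0" using a(3) U(3) by auto
      ultimately show "\<exists>a\<in>A - {0}. \<exists>v\<in>V. norm a < \<epsilon> \<and> norm (a - v) \<le> \<epsilon> * norm a"
        using a v an by (intro bexI[of _ a] bexI[of _ v]) auto
    qed
  qed
qed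

theorem theorem3p11:
  fixes V W A :: "(complex^'n) set" and h :: "complex^'n \<Rightarrow> complex^'n" and U :: "(complex^'n) set"
  assumes "analytic_variety_germ V" and "analytic_variety_germ W"
    and "0 \<in> V" and "0 \<in> W"
    and "0 \<in> closure A"
    and "bilipschitz_germ_on h U"
    and "\<exists>r>0. h ` (V \<inter> U) \<inter> ball 0 r = W \<inter> ball 0 r"
  shows "LDstar A \<inter> LDstar V = {0} \<longleftrightarrow> LDstar (h ` (A \<inter> U)) \<inter> LDstar W = {0}"
proof -
  obtain r where r: "r > 0" "h ` (V \<inter> U) \<inter> ball 0 r = W \<inter> ball 0 r" using assms(7) by blast
  \<comment> \<open>The image of V and the set W agree only near 0, so exchanging them rests on the
    locality of \<open>tangential\<close>.\<close>
  have "tangential B (h ` (V \<inter> U)) \<longleftrightarrow> tangential B W" for B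
    using tangential_local[OF _ r(1)] r(2) by metis
  moreover have "tangential (h ` (V \<inter> U)) (h ` (V \<inter> U)) \<longleftrightarrow> tangential W W"
    using tangential_self_local[OF _ r(1)] r(2) by metis
  ultimately show ?thesis
    using tangential_bilipschitz[OF assms(6)]
    unfolding cones_transversal_iff[OF assms(1)] cones_transversal_iff[OF assms(2)] by blast
qed

end
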